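(* Let $\psi:\mathbb{N}\to\mathbb{R}$ be non-negative and decreasing, and let $\mathcal{D}=\{n_k\}_{k\ge0}$ be a pseudo-absolute value sequence satisfying \[\sum_{k=1}^{\mathcal{M}(N)}\frac{\varphi(n_k)}{n_k}\gg \mathcal{M}(N)\quad\text{for all } N\in\mathbb{N}\] (i.e. the left side is at least $c\,\mathcal{M}(N)$ for some constant $c>0$ independent of $N$). Then for Lebesgue-almost every $\alpha\in\mathbb{R}$ the inequality \[|n|_{\mathcal{D}}\,\|n\alpha\|\le \psi(n)\] has infinitely many solutions $n\in\mathbb{N}$ if $\sum_{n=1}^\infty \mathcal{M}(n)\psi(n)$ diverges, and only finitely many solutions $n\in\mathbb{N}$ if this sum converges.
   Context: For $x\in\mathbb{R}$, $\|x\|$ denotes the distance from $x$ to the nearest integer; $\varphi$ is Euler's totient function. A pseudo-absolute value sequence is an increasing sequence $\mathcal{D}=\{n_k\}_{k\ge0}$ of positive integers with $n_0=1$ and $n_k\mid n_{k+1}$ for all $k$; its pseudo-absolute value is $|n|_{\mathcal{D}}=\min\{n_k^{-1}: n\in n_k\mathbb{Z}\}$ for $n\in\mathbb{N}$. Define $\mathcal{M}:\mathbb{N}\to\mathbb{N}\cup\{0\}$ by $\mathcal{M}(N)=\max\{k: n_k\le N\}$. *)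

theory Defs
  imports "HOL-Analysis.Analysis" "HOL-Number_Theory.Totient"
begin

definition pseudo_abs_seq :: "(nat \<Rightarrow> nat) \<Rightarrow> bool" where
  "pseudo_abs_seq D \<longleftrightarrow> strict_mono D \<and> D 0 = 1 \<and> (\<forall>k. D k dvd D (Suc k))"

(* Meaningful for n > 0 only: then the set is finite, and contains 1 because D 0 = 1. *)
definition pseudo_abs :: "(nat \<Rightarrow> nat) \<Rightarrow> nat \<Rightarrow> real" where
  "pseudo_abs D n = Min {1 / real (D k) | k. D k dvd n}"

(* Meaningful for N > 0 only: then the set is finite and contains 0. *)
definition seq_count :: "(nat \<Rightarrow> nat) \<Rightarrow> nat \<Rightarrow> nat" where
  "seq_count D N = Max {k. D k \<le> N}"

definition int_dist :: "real \<Rightarrow> real" where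
  "int_dist x = infdist x \<int>"

end

theory Submission imports Defs begin

text \<open>
  Write \<open>f n = \<psi> n / |n|\<^sub>D\<close>, so that the inequality reads \<open>\<parallel>n\<alpha>\<parallel> \<le> f n\<close>. Since \<open>1 / |n|\<^sub>D\<close> is
  comparable with the sum of the \<open>n\<^sub>k\<close> dividing \<open>n\<close>, the series over \<open>f\<close> is comparable with the series
  over \<open>\<M> \<psi>\<close>, and convergence is Borel--Cantelli.

  For divergence, \<open>\<phi>(n\<^sub>k) / n\<^sub>k\<close> is decreasing in \<open>k\<close>, so the hypothesis on its averages bounds every
  term below by \<open>c\<close>. As \<open>\<phi>(d) / d\<close> is at least \<open>1 / 2\<close> on average, the sums of \<open>\<phi>(n) f(n) / n\<close> and
  of \<open>f(n)\<close> over the \<open>n \<le> N\<close> divisible by \<open>n\<^sub>K\<close> are comparable, uniformly in \<open>K\<close>. The Duffin--Schaeffer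
  overlap estimate for neighbourhoods of reduced fractions and a second moment argument then show
  that \<open>\<parallel>n\<alpha>\<parallel> \<le> f n\<close> holds for infinitely many multiples \<open>n\<close> of \<open>n\<^sub>K\<close> on a subset of \<open>[0, 1]\<close> whose measure
  is bounded below independently of \<open>K\<close>. No zero-one law is needed: that set is invariant under
  translation by \<open>1 / n\<^sub>K\<close>, so the solution set has relative measure bounded below in every interval
  \<open>[i / n\<^sub>K, (i + 1) / n\<^sub>K)\<close>, and hence full measure.
\<close>

section \<open>Totients and decreasing sequences\<close>

text \<open>By \<open>totient_gcd\<close>, phi(ab) phi(g) = phi(a) phi(b) g with g = gcd(a, b).
  Since phi(g) <= g, the factor phi(g) can be cancelled.\<close>

lemma totient_mult_ge: "totient a * totient b \<le> totient (a * b)"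
proof (cases "gcd a b = 0")
  case False
  have "totient a * totient b * totient (gcd a b) \<le> totient a * totient b * gcd a b"
    by (intro mult_left_mono totient_le) auto
  also have "\<dots> = totient (a * b) * totient (gcd a b)"
    by (rule totient_gcd [symmetric])
  finally show ?thesis using False by (subst (asm) mult_le_cancel2) auto
qed auto

text \<open>phi(n)/n is the product of 1 - 1/p over the primes p dividing n. All factors lie in
  [0, 1], and every prime factor of m is one of n.\<close>

lemma totient_ratio_antimono:
  assumes "m dvd n" "n > 0"
  shows "real (totient n) / real n \<le> real (totient m) / real m"
proof -
  have "m > 0" using assms by (auto intro: Nat.gr0I)
  have ratio: "real (totient k) / real k = (\<Prod>p\<in>prime_factors k. 1 - 1 / real p)" if "k > 0" for k
    using that totient_formula2 [of k] by simp
  have p: "0 \<le> 1 - 1 / real p \<and> 1 - 1 / real p \<le> 1" if "p \<in> prime_factors n" for p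
    using that by (auto simp: in_prime_factors_iff dest!: prime_gt_1_nat)
  have sub: "prime_factors m \<subseteq> prime_factors n"
    using assms by (intro dvd_prime_factors) auto
  have "(\<Prod>p\<in>prime_factors n. 1 - 1 / real p)
      = (\<Prod>p\<in>prime_factors n - prime_factors m. 1 - 1 / real p) * (\<Prod>p\<in>prime_factors m. 1 - 1 / real p)"
    by (rule prod.subset_diff [OF sub]) auto
  also have "\<dots> \<le> 1 * (\<Prod>p\<in>prime_factors m. 1 - 1 / real p)"
    using p sub by (intro mult_right_mono prod_le_1 prod_nonneg) blast+
  finally have "(\<Prod>p\<in>prime_factors n. 1 - 1 / real p) \<le> (\<Prod>p\<in>prime_factors m. 1 - 1 / real p)"
    by simp
  then show ?thesis using assms \<open>m > 0\<close> by (simp add: ratio)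
qed

text \<open>Sum j = sum of phi(d) over d | j for all j <= J. The left side is J(J + 1)/2; on the
  right each d has at most J/d multiples, so the right side is at most J times the sum in
  question.\<close>

lemma sum_totient_ratio_ge:
  "(\<Sum>d=1..J. real (totient d) / real d) \<ge> real J / 2"
proof (cases "J = 0")
  case False
  have "real J * real (J + 1) / 2 = (\<Sum>j=1..J. real j)"
    by (induction J) (simp_all add: field_simps)
  also have "\<dots> = (\<Sum>j=1..J. \<Sum>d\<in>{d\<in>{1..J}. d dvd j}. real (totient d))"
  proof (rule sum.cong [OF refl])
    fix j assume j: "j \<in> {1..J}"
    then have "{d\<in>{1..J}. d dvd j} = {d. d dvd j}"
      by (auto intro: Nat.gr0I dest: dvd_imp_le)
    moreover have "real j = (\<Sum>d | d dvd j. real (totient d))"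
      unfolding of_nat_sum [symmetric] totient_divisor_sum ..
    ultimately show "real j = (\<Sum>d\<in>{d\<in>{1..J}. d dvd j}. real (totient d))" by simp
  qed
  also have "\<dots> = (\<Sum>d=1..J. \<Sum>j\<in>{j\<in>{1..J}. d dvd j}. real (totient d))"
    by (rule sum.swap_restrict) auto
  also have "\<dots> \<le> (\<Sum>d=1..J. real (totient d) * (real J / real d))"
  proof (rule sum_mono)
    fix d assume "d \<in> {1..J}"
    then have "d > 0" by simp
    have "{j\<in>{1..J}. d dvd j} \<subseteq> (\<lambda>i. d * i) ` {1..J div d}"
    proof
      fix j assume j: "j \<in> {j\<in>{1..J}. d dvd j}"
      then obtain i where i: "j = d * i" by blast
      have "i \<in> {1..J div d}"
        using j \<open>d > 0\<close> unfolding i by (auto simp: less_eq_div_iff_mult_less_eq mult.commute)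
      then show "j \<in> (\<lambda>i. d * i) ` {1..J div d}" unfolding i by blast
    qed
    then have "card {j\<in>{1..J}. d dvd j} \<le> J div d"
      using surj_card_le [of "{1..J div d}"] by (metis card_atLeastAtMost diff_Suc_1 finite_atLeastAtMost)
    then have "real (card {j\<in>{1..J}. d dvd j}) \<le> real (J div d)" by simp
    also have "\<dots> \<le> real J / real d" by (rule of_nat_div_le_of_nat)
    finally have "real (card {j\<in>{1..J}. d dvd j}) \<le> real J / real d" .
    then show "(\<Sum>j\<in>{j\<in>{1..J}. d dvd j}. real (totient d)) \<le> real (totient d) * (real J / real d)"
      by (simp add: mult.commute mult_left_mono del: times_divide_eq_right)
  qed
  also have "\<dots> = real J * (\<Sum>d=1..J. real (totient d) / real d)"
    by (simp add: sum_distrib_left mult_ac)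
  finally have "real J * (real (J + 1) / 2) \<le> real J * (\<Sum>d=1..J. real (totient d) / real d)"
    by simp
  then have "real (J + 1) / 2 \<le> (\<Sum>d=1..J. real (totient d) / real d)"
    using False by (subst (asm) mult_le_cancel_left_pos) auto
  then show ?thesis by simp
qed auto

text \<open>Carries a comparison of partial sums over to decreasing weights. It serves to replace
  phi(j)/j by 1/2 under the weights psi(n_k j).\<close>

lemma decreasing_sum_mono:
  fixes u a b :: "nat \<Rightarrow> real"
  assumes nonneg: "\<And>j. 1 \<le> j \<Longrightarrow> 0 \<le> u j" and dec: "\<And>j. 1 \<le> j \<Longrightarrow> u (Suc j) \<le> u j"
    and partial: "\<And>J. (\<Sum>j=1..J. b j) \<le> (\<Sum>j=1..J. a j)"
  shows "(\<Sum>j=1..J. u j * b j) \<le> (\<Sum>j=1..J. u j * a j)"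
proof -
  define A where "A J = (\<Sum>j=1..J. a j - b j)" for J
  have A: "0 \<le> A J" for J using partial [of J] by (simp add: A_def sum_subtractf)
  \<comment> \<open>summation by parts\<close>
  have "u (Suc J) * A J \<le> (\<Sum>j=1..J. u j * (a j - b j))" for J
  proof (induction J)
    case (Suc J)
    have "u (Suc (Suc J)) * A (Suc J) \<le> u (Suc J) * A (Suc J)"
      by (intro mult_right_mono dec A) auto
    also have "\<dots> = u (Suc J) * A J + u (Suc J) * (a (Suc J) - b (Suc J))"
      by (simp add: A_def algebra_simps)
    also have "\<dots> \<le> (\<Sum>j=1..Suc J. u j * (a j - b j))" using Suc by simp
    finally show ?case .
  qed (simp add: A_def)
  from this [of J] have "0 \<le> (\<Sum>j=1..J. u j * (a j - b j))"
    using mult_nonneg_nonneg [OF nonneg A, of "Suc J" J] by linarith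
  then show ?thesis by (simp add: algebra_simps sum_subtractf)
qed

text \<open>If u_k < c, no later term exceeds u_k, so the first k + L terms sum to at most k + L
  u_k, which is below c (k + L) once L is large.\<close>

lemma decreasing_average_ge:
  fixes u :: "nat \<Rightarrow> real"
  assumes dec: "\<And>i j. i \<le> j \<Longrightarrow> u j \<le> u i" and le1: "\<And>k. u k \<le> 1"
    and avg: "\<And>M. (\<Sum>k=1..M. u k) \<ge> c * real M"
  shows "u k \<ge> c"
proof (rule ccontr)
  assume "\<not> u k \<ge> c"
  then have pos: "c - u k > 0" by simp
  \<comment> \<open>This L gives (c - u_k) L > (1 - u_k) k, whereas the average bound will force (c
    - u_k) L <= (1 - c) k.\<close>
  obtain L :: nat where L: "(1 - u k) * real k / (c - u k) < real L" using reals_Archimedean2 by blast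
  have "c * real (k + L) \<le> (\<Sum>j=1..k+L. u j)" by (rule avg)
  also have "\<dots> \<le> (\<Sum>j=1..k+L. if j \<le> k then 1 else u k)"
    using dec le1 by (intro sum_mono) auto
  also have "\<dots> = (\<Sum>j=1..k. 1) + (\<Sum>j=k+1..k+L. u k)"
    by (subst sum.ub_add_nat) (auto intro!: arg_cong2 [where f = "(+)"] sum.cong)
  also have "\<dots> = real k + real L * u k" by simp
  finally have "(c - u k) * real L \<le> (1 - c) * real k" by (simp add: algebra_simps)
  also have "\<dots> \<le> (1 - u k) * real k" using pos by (intro mult_right_mono) auto
  finally show False using L pos by (simp add: field_simps)
qed

section \<open>Sums over a pseudo-absolute value sequence\<close>

context
  fixes D :: "nat \<Rightarrow> nat"
  assumes D: "pseudo_abs_seq D"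
begin

lemma
  shows pas_strict_mono: "strict_mono D" and pas_0: "D 0 = 1" and pas_pos: "D k > 0"
    and pas_ge: "k \<le> D k"
proof -
  show *: "strict_mono D" "D 0 = 1" using D by (auto simp: pseudo_abs_seq_def)
  then have "D 0 \<le> D k" unfolding strict_mono_less_eq [OF *(1)] by simp
  then show "D k > 0" using * by simp
  show "k \<le> D k" using * by (simp add: strict_mono_imp_increasing)
qed

lemma pas_dvd: "i \<le> j \<Longrightarrow> D i dvd D j"
proof (induction rule: dec_induct)
  case (step n)
  then show ?case using D dvd_trans unfolding pseudo_abs_seq_def by blast
qed auto

lemma pas_double: "2 * D k \<le> D (Suc k)"
proof -
  obtain r where r: "D (Suc k) = D k * r" using pas_dvd [of k "Suc k"] by auto
  moreover have "D k < D (Suc k)" using pas_strict_mono by (simp add: strict_mono_less)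
  ultimately have "2 \<le> r" by (cases r) (auto simp: numeral_2_eq_2 Suc_le_eq intro: Nat.gr0I)
  then show ?thesis by (simp add: r)
qed

text \<open>Each term is at least twice its predecessor, so the last one dominates as in a geometric
  series.\<close>

lemma sum_pas_le: "(\<Sum>k\<le>K. D k) \<le> 2 * D K"
proof (induction K)
  case (Suc K)
  then show ?case using pas_double [of K] by simp
qed simp

text \<open>Trades the \<open>Max\<close> in \<open>seq_count\<close> for an order equivalence. The
  bound k <= n_k makes the set finite, and N >= 1 puts 0 into it.\<close>

lemma le_seq_count_iff:
  assumes "N \<ge> 1"
  shows "k \<le> seq_count D N \<longleftrightarrow> D k \<le> N"
proof -
  have fin: "finite {k. D k \<le> N}"
    by (rule finite_subset [of _ "{..N}"]) (auto intro: order_trans [OF pas_ge])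
  have ne: "0 \<in> {k. D k \<le> N}" using assms by (simp add: pas_0)
  have *: "D (seq_count D N) \<le> N"
    using Max_in [OF fin] ne unfolding seq_count_def by blast
  show ?thesis
  proof
    assume "k \<le> seq_count D N"
    then have "D k \<le> D (seq_count D N)" by (simp add: strict_mono_less_eq [OF pas_strict_mono])
    with * show "D k \<le> N" by simp
  next
    assume "D k \<le> N"
    then show "k \<le> seq_count D N" using Max_ge [OF fin, of k] unfolding seq_count_def by simp
  qed
qed

lemma seq_count_pas: "seq_count D (D k) = k"
proof -
  have "j \<le> seq_count D (D k) \<longleftrightarrow> j \<le> k" for j
    using pas_pos [of k] pas_strict_mono by (simp add: le_seq_count_iff strict_mono_less_eq)
  from this [of k] this [of "seq_count D (D k)"] show ?thesis by simp
qed

text \<open>The minimum is attained at the largest index k with n_k | n, which exists because k <=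
  n_k <= n for all such indices.\<close>

lemma pseudo_abs_eq:
  assumes "n \<ge> 1"
  obtains k where "D k dvd n" "\<And>j. D j dvd n \<Longrightarrow> j \<le> k" "pseudo_abs D n = 1 / real (D k)"
proof -
  define S where "S = {k. D k dvd n}"
  have "k \<le> n" if "k \<in> S" for k
    using dvd_imp_le [of "D k" n] pas_ge [of k] that assms unfolding S_def by auto
  then have fin: "finite S" by (intro finite_subset [of S "{..n}"]) auto
  have ne: "S \<noteq> {}" using pas_0 unfolding S_def by (auto intro!: exI [of _ 0])
  define k where "k = Max S"
  have k: "k \<in> S" "\<And>j. j \<in> S \<Longrightarrow> j \<le> k" using fin ne by (auto simp: k_def)
  have "pseudo_abs D n = Min ((\<lambda>k. 1 / real (D k)) ` S)"
    unfolding pseudo_abs_def S_def by (rule arg_cong [where f = Min]) auto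
  also have "\<dots> = 1 / real (D k)"
  proof (rule Min_eqI)
    fix y assume "y \<in> (\<lambda>k. 1 / real (D k)) ` S"
    then obtain j where j: "j \<in> S" "y = 1 / real (D j)" by blast
    then have "D j \<le> D k" using k pas_strict_mono by (simp add: strict_mono_less_eq)
    then show "1 / real (D k) \<le> y" using j pas_pos [of j] by (simp add: frac_le)
  qed (use fin k in auto)
  finally show ?thesis using that [of k] k unfolding S_def by auto
qed

lemma pseudo_abs_pos: "n \<ge> 1 \<Longrightarrow> pseudo_abs D n > 0"
  by (erule pseudo_abs_eq) (simp add: pas_pos)

text \<open>1/|n|_D is the largest n_k dividing n: it is one of the summands, and by
  \<open>sum_pas_le\<close> it is at least half of their sum. Turning a maximum into a sum makes it
  possible to interchange summations. The largest index lies in {K..N} because n_K | n and k <= n_k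
  <= N.\<close>

lemma inverse_pseudo_abs_bounds:
  assumes n: "n \<in> {1..N}" and K: "D K dvd n"
  shows "1 / pseudo_abs D n \<le> (\<Sum>k\<in>{k\<in>{K..N}. D k dvd n}. real (D k))"
    and "(\<Sum>k\<in>{k\<in>{K..N}. D k dvd n}. real (D k)) \<le> 2 / pseudo_abs D n"
proof -
  from n have "n \<ge> 1" by simp
  then obtain k where k: "D k dvd n" "\<And>j. D j dvd n \<Longrightarrow> j \<le> k" "pseudo_abs D n = 1 / real (D k)"
    using pseudo_abs_eq by metis
  have "D k \<le> N" using k(1) n by (auto dest: dvd_imp_le)
  then have mem: "k \<in> {k\<in>{K..N}. D k dvd n}" using k K pas_ge [of k] by auto
  show "1 / pseudo_abs D n \<le> (\<Sum>k\<in>{k\<in>{K..N}. D k dvd n}. real (D k))"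
    using member_le_sum [OF mem, of "\<lambda>k. real (D k)"] k(3) by simp
  have "(\<Sum>k\<in>{k\<in>{K..N}. D k dvd n}. real (D k)) \<le> (\<Sum>j\<le>k. real (D j))"
    using k(2) by (intro sum_mono2) auto
  also have "\<dots> \<le> real (2 * D k)" unfolding of_nat_sum [symmetric] of_nat_le_iff by (rule sum_pas_le)
  finally show "(\<Sum>k\<in>{k\<in>{K..N}. D k dvd n}. real (D k)) \<le> 2 / pseudo_abs D n" using k(3) by simp
qed

lemma sum_divisor_swap:
  fixes g :: "nat \<Rightarrow> real"
  shows "(\<Sum>n | n \<in> {1..N} \<and> D K dvd n. g n * (\<Sum>k\<in>{k\<in>{K..N}. D k dvd n}. real (D k)))
       = (\<Sum>k=K..N. real (D k) * (\<Sum>j=1..N div D k. g (D k * j)))"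
proof -
  have "(\<Sum>n | n \<in> {1..N} \<and> D K dvd n. g n * (\<Sum>k\<in>{k\<in>{K..N}. D k dvd n}. real (D k)))
      = (\<Sum>n\<in>{n. n \<in> {1..N} \<and> D K dvd n}. \<Sum>k\<in>{k\<in>{K..N}. D k dvd n}. g n * real (D k))"
    by (simp add: sum_distrib_left)
  also have "\<dots> = (\<Sum>k=K..N. \<Sum>n\<in>{n\<in>{n. n \<in> {1..N} \<and> D K dvd n}. D k dvd n}. g n * real (D k))"
    by (rule sum.swap_restrict) auto
  also have "\<dots> = (\<Sum>k=K..N. real (D k) * (\<Sum>j=1..N div D k. g (D k * j)))"
  proof (rule sum.cong [OF refl])
    fix k assume k: "k \<in> {K..N}"
    \<comment> \<open>For k >= K a multiple of n_k is automatically a multiple of n_K, so the outer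
      restriction disappears.\<close>
    have "{n\<in>{n. n \<in> {1..N} \<and> D K dvd n}. D k dvd n} = {n. n \<in> {1..N} \<and> D k dvd n}"
      using pas_dvd [of K k] k dvd_trans by auto
    moreover have "bij_betw (\<lambda>j. D k * j) {1..N div D k} {n. n \<in> {1..N} \<and> D k dvd n}"
    proof (rule bij_betw_byWitness [where f' = "\<lambda>n. n div D k"])
      show "(\<lambda>j. D k * j) ` {1..N div D k} \<subseteq> {n. n \<in> {1..N} \<and> D k dvd n}"
        using pas_pos [of k] by (auto simp: less_eq_div_iff_mult_less_eq mult.commute)
      show "(\<lambda>n. n div D k) ` {n. n \<in> {1..N} \<and> D k dvd n} \<subseteq> {1..N div D k}"
        using pas_pos [of k] by (auto simp: div_le_mono dvd_imp_le div_greater_zero_iff Suc_le_eq)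
    qed (use pas_pos [of k] in auto)
    ultimately show "(\<Sum>n\<in>{n\<in>{n. n \<in> {1..N} \<and> D K dvd n}. D k dvd n}. g n * real (D k))
        = real (D k) * (\<Sum>j=1..N div D k. g (D k * j))"
      by (simp add: sum.reindex_bij_betw [symmetric] sum_distrib_left mult.commute)
  qed
  finally show ?thesis .
qed

lemma sum_over_pseudo_abs_bounds:
  fixes g :: "nat \<Rightarrow> real"
  assumes g: "\<And>n. n \<ge> 1 \<Longrightarrow> g n \<ge> 0"
  shows "(\<Sum>n | n \<in> {1..N} \<and> D K dvd n. g n / pseudo_abs D n)
       \<le> (\<Sum>k=K..N. real (D k) * (\<Sum>j=1..N div D k. g (D k * j)))"
    and "(\<Sum>k=K..N. real (D k) * (\<Sum>j=1..N div D k. g (D k * j)))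
       \<le> 2 * (\<Sum>n | n \<in> {1..N} \<and> D K dvd n. g n / pseudo_abs D n)"
proof -
  let ?s = "\<lambda>n. \<Sum>k\<in>{k\<in>{K..N}. D k dvd n}. real (D k)"
  have "(\<Sum>n | n \<in> {1..N} \<and> D K dvd n. g n * (1 / pseudo_abs D n))
      \<le> (\<Sum>n | n \<in> {1..N} \<and> D K dvd n. g n * ?s n)"
    using inverse_pseudo_abs_bounds(1) g by (intro sum_mono mult_left_mono) auto
  then show "(\<Sum>n | n \<in> {1..N} \<and> D K dvd n. g n / pseudo_abs D n)
       \<le> (\<Sum>k=K..N. real (D k) * (\<Sum>j=1..N div D k. g (D k * j)))"
    unfolding sum_divisor_swap by simp
  have "(\<Sum>n | n \<in> {1..N} \<and> D K dvd n. g n * ?s n)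
      \<le> (\<Sum>n | n \<in> {1..N} \<and> D K dvd n. g n * (2 / pseudo_abs D n))"
    using inverse_pseudo_abs_bounds(2) g by (intro sum_mono mult_left_mono) auto
  then show "(\<Sum>k=K..N. real (D k) * (\<Sum>j=1..N div D k. g (D k * j)))
       \<le> 2 * (\<Sum>n | n \<in> {1..N} \<and> D K dvd n. g n / pseudo_abs D n)"
    unfolding sum_divisor_swap by (simp add: sum_distrib_left mult.commute)
qed

text \<open>The indices are K, ..., M(m). Counting from 0 accounts for the \<open>Suc\<close>, and
  truncated subtraction returns 0 when M(m) < K.\<close>

lemma card_pas_le:
  assumes "m \<in> {1..N}"
  shows "card {k\<in>{K..N}. D k \<le> m} = Suc (seq_count D m) - K"
proof -
  have "seq_count D m \<le> N"
    using le_seq_count_iff [of m "seq_count D m"] assms pas_ge [of "seq_count D m"] by simp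
  then have "{k\<in>{K..N}. k \<le> seq_count D m} = {K..seq_count D m}" by auto
  then have "{k\<in>{K..N}. D k \<le> m} = {K..seq_count D m}"
    using assms by (simp add: le_seq_count_iff)
  then show ?thesis by simp
qed

section \<open>Comparing weighted divisor sums with the series over M psi\<close>

context
  fixes \<psi> :: "nat \<Rightarrow> real"
  assumes nonneg: "\<And>n. n \<ge> 1 \<Longrightarrow> \<psi> n \<ge> 0"
    and decreasing: "\<And>m n. 1 \<le> m \<Longrightarrow> m \<le> n \<Longrightarrow> \<psi> n \<le> \<psi> m"
begin

text \<open>Cut the range from d onwards into blocks [dj, d(j + 1)) of d integers; on each of them
  psi is at most psi(dj).\<close>

lemma sum_le_sum_multiples:
  assumes "d \<ge> 1"
  shows "(\<Sum>m=d..N. \<psi> m) \<le> real d * (\<Sum>j=1..N div d. \<psi> (d * j))"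
proof -
  have *: "(\<Sum>m\<in>{d..<d * Suc J}. \<psi> m) \<le> real d * (\<Sum>j=1..J. \<psi> (d * j))" for J
  proof (induction J)
    case (Suc J)
    have "(\<Sum>m\<in>{d..<d * Suc (Suc J)}. \<psi> m)
        = (\<Sum>m\<in>{d..<d * Suc J}. \<psi> m) + (\<Sum>m\<in>{d * Suc J..<d * Suc (Suc J)}. \<psi> m)"
      by (rule sum.atLeastLessThan_concat [symmetric]) auto
    also have "(\<Sum>m\<in>{d * Suc J..<d * Suc (Suc J)}. \<psi> m)
        \<le> (\<Sum>m\<in>{d * Suc J..<d * Suc (Suc J)}. \<psi> (d * Suc J))"
      using assms by (intro sum_mono decreasing) auto
    finally show ?case using Suc by (simp add: algebra_simps)
  qed simp
  have "N < d * Suc (N div d)" using assms by (simp add: dividend_less_times_div)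
  then have "(\<Sum>m=d..N. \<psi> m) \<le> (\<Sum>m\<in>{d..<d * Suc (N div d)}. \<psi> m)"
    using assms nonneg by (intro sum_mono2) auto
  then show ?thesis using * [of "N div d"] by linarith
qed

text \<open>Here psi(dj) is compared with the block of d integers ending at dj. The first block is
  cut down to (e, d], which still has at least d/2 elements; this costs the factor 2. It is applied
  with d = n_{k+1} and e = n_k, where \<open>pas_double\<close> supplies 2e <= d.\<close>

lemma sum_multiples_le_sum:
  assumes "2 * e \<le> d" "d \<ge> 1"
  shows "real d * (\<Sum>j=1..N div d. \<psi> (d * j)) \<le> 2 * (\<Sum>m=Suc e..N. \<psi> m)"
proof (cases "N div d")
  case 0
  then show ?thesis using nonneg by (auto intro!: sum_nonneg)
next
  case (Suc J)
  have *: "real d * (\<Sum>j=1..Suc J. \<psi> (d * j)) \<le> 2 * (\<Sum>m=Suc e..d * Suc J. \<psi> m)" for J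
  proof (induction J)
    case 0
    have "real d \<le> 2 * real (d - e)" using assms by linarith
    then have "real d * \<psi> d \<le> 2 * real (d - e) * \<psi> d"
      using nonneg [of d] assms by (intro mult_right_mono) auto
    then have "real d * \<psi> d \<le> 2 * (real (d - e) * \<psi> d)" by (simp only: mult.assoc)
    also have "real (d - e) * \<psi> d = (\<Sum>m=Suc e..d. \<psi> d)" by simp
    also have "\<dots> \<le> (\<Sum>m=Suc e..d. \<psi> m)" using decreasing by (intro sum_mono) auto
    finally show ?case by simp
  next
    case (Suc J)
    have "real d * \<psi> (d * Suc (Suc J)) = (\<Sum>m=Suc (d * Suc J)..d * Suc (Suc J). \<psi> (d * Suc (Suc J)))"
      by simp
    also have "\<dots> \<le> (\<Sum>m=Suc (d * Suc J)..d * Suc (Suc J). \<psi> m)"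
      using decreasing by (intro sum_mono) auto
    also have "\<dots> \<le> 2 * \<dots>" using nonneg by (auto intro!: sum_nonneg)
    finally have "real d * \<psi> (d * Suc (Suc J)) \<le> 2 * (\<Sum>m=Suc (d * Suc J)..d * Suc (Suc J). \<psi> m)" .
    moreover have "(\<Sum>m=Suc e..d * Suc (Suc J). \<psi> m)
        = (\<Sum>m=Suc e..d * Suc J. \<psi> m) + (\<Sum>m=Suc (d * Suc J)..d * Suc (Suc J). \<psi> m)"
      using assms sum.ub_add_nat [of "Suc e" "d * Suc J" \<psi> d] by (simp add: algebra_simps)
    ultimately show ?case using Suc by (simp add: algebra_simps)
  qed
  have "d * (N div d) \<le> N" by simp
  then have "(\<Sum>m=Suc e..d * (N div d). \<psi> m) \<le> (\<Sum>m=Suc e..N. \<psi> m)"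
    using nonneg by (intro sum_mono2) auto
  then show ?thesis using * [of J] unfolding Suc by linarith
qed

text \<open>After interchanging the sums, psi(m) is counted once for each index k >= K with n_k <=
  m, whence the function M appears.\<close>

lemma sum_tails_eq:
  "(\<Sum>k=K..N. \<Sum>m=D k..N. \<psi> m) = (\<Sum>m=1..N. real (Suc (seq_count D m) - K) * \<psi> m)"
proof -
  have "(\<Sum>k=K..N. \<Sum>m=D k..N. \<psi> m) = (\<Sum>k=K..N. \<Sum>m\<in>{m\<in>{1..N}. D k \<le> m}. \<psi> m)"
    by (intro sum.cong) (auto simp: Suc_le_eq intro: order_less_le_trans [OF pas_pos])
  also have "\<dots> = (\<Sum>m=1..N. \<Sum>k\<in>{k\<in>{K..N}. D k \<le> m}. \<psi> m)"
    by (rule sum.swap_restrict) auto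
  also have "\<dots> = (\<Sum>m=1..N. real (Suc (seq_count D m) - K) * \<psi> m)"
    using card_pas_le by (intro sum.cong) auto
  finally show ?thesis .
qed

lemma sum_over_pseudo_abs_ge:
  "(\<Sum>m=1..N. real (Suc (seq_count D m) - K) * \<psi> m)
     \<le> 2 * (\<Sum>n | n \<in> {1..N} \<and> D K dvd n. \<psi> n / pseudo_abs D n)"
proof -
  have "(\<Sum>k=K..N. \<Sum>m=D k..N. \<psi> m) \<le> (\<Sum>k=K..N. real (D k) * (\<Sum>j=1..N div D k. \<psi> (D k * j)))"
    using pas_pos by (intro sum_mono sum_le_sum_multiples) (simp add: Suc_le_eq)
  also have "\<dots> \<le> 2 * (\<Sum>n | n \<in> {1..N} \<and> D K dvd n. \<psi> n / pseudo_abs D n)"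
    by (rule sum_over_pseudo_abs_bounds(2) [OF nonneg])
  finally show ?thesis by (simp add: sum_tails_eq)
qed

text \<open>The index k + 1 is charged to the tail of psi from n_k, and k = 0 contributes the plain
  sum of psi. The weight of psi(m) is therefore 1 + 2 (M(m) + 1) = 2 M(m) + 3.\<close>

lemma sum_over_pseudo_abs_le:
  "(\<Sum>n=1..N. \<psi> n / pseudo_abs D n) \<le> (\<Sum>m=1..N. (2 * real (seq_count D m) + 3) * \<psi> m)"
proof -
  have *: "real (D (Suc k)) * (\<Sum>j=1..N div D (Suc k). \<psi> (D (Suc k) * j)) \<le> 2 * (\<Sum>m=D k..N. \<psi> m)" for k
  proof -
    have "real (D (Suc k)) * (\<Sum>j=1..N div D (Suc k). \<psi> (D (Suc k) * j)) \<le> 2 * (\<Sum>m=Suc (D k)..N. \<psi> m)"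
      using pas_pos pas_double by (intro sum_multiples_le_sum) (simp_all add: Suc_le_eq)
    also have "(\<Sum>m=Suc (D k)..N. \<psi> m) \<le> (\<Sum>m=D k..N. \<psi> m)"
      using nonneg pas_pos [of k] by (intro sum_mono2) auto
    finally show ?thesis by simp
  qed
  have "(\<Sum>n=1..N. \<psi> n / pseudo_abs D n) = (\<Sum>n | n \<in> {1..N} \<and> D 0 dvd n. \<psi> n / pseudo_abs D n)"
    by (intro sum.cong) (auto simp: pas_0)
  also have "\<dots> \<le> (\<Sum>k=0..N. real (D k) * (\<Sum>j=1..N div D k. \<psi> (D k * j)))"
    by (rule sum_over_pseudo_abs_bounds(1) [OF nonneg])
  \<comment> \<open>One extra nonnegative term, so that splitting off k = 0 leaves indices k + 1
    with k in {0..N}.\<close>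
  also have "\<dots> \<le> (\<Sum>k=0..Suc N. real (D k) * (\<Sum>j=1..N div D k. \<psi> (D k * j)))"
    using nonneg pas_pos by (intro sum_mono2 mult_nonneg_nonneg sum_nonneg) (auto simp: Suc_le_eq)
  also have "\<dots> = (\<Sum>j=1..N. \<psi> j) + (\<Sum>k=0..N. real (D (Suc k)) * (\<Sum>j=1..N div D (Suc k). \<psi> (D (Suc k) * j)))"
    by (subst sum.atLeast0_atMost_Suc_shift) (simp add: pas_0 o_def)
  also have "\<dots> \<le> (\<Sum>j=1..N. \<psi> j) + (\<Sum>k=0..N. 2 * (\<Sum>m=D k..N. \<psi> m))"
    using * by (intro add_left_mono sum_mono)
  also have "\<dots> = (\<Sum>j=1..N. \<psi> j) + 2 * (\<Sum>m=1..N. real (Suc (seq_count D m)) * \<psi> m)"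
    using sum_tails_eq [of N 0] by (simp add: sum_distrib_left [symmetric])
  also have "\<dots> = (\<Sum>m=1..N. (2 * real (seq_count D m) + 3) * \<psi> m)"
    by (simp add: sum_distrib_left sum.distrib [symmetric] algebra_simps)
  finally show ?thesis .
qed

text \<open>Supermultiplicativity gives phi(n_k j)/(n_k j) >= c phi(j)/j, and phi(j)/j counts as 1/2
  under the decreasing weights psi(n_k j). Another factor 2 is lost in returning from the double sum
  to 1/|n|_D, so the constant is c/4.\<close>

lemma sum_over_pseudo_abs_totient_ge:
  assumes c: "\<And>k. real (totient (D k)) / real (D k) \<ge> c" "c > 0"
  shows "c / 4 * (\<Sum>n | n \<in> {1..N} \<and> D K dvd n. \<psi> n / pseudo_abs D n)
    \<le> (\<Sum>n | n \<in> {1..N} \<and> D K dvd n. real (totient n) / real n * (\<psi> n / pseudo_abs D n))"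
proof -
  have *: "c / 2 * (\<Sum>j=1..J. \<psi> (D k * j))
      \<le> (\<Sum>j=1..J. \<psi> (D k * j) * (real (totient (D k * j)) / real (D k * j)))" for k J
  proof -
    have pos: "D k * j \<ge> 1" if "j \<ge> 1" for j using pas_pos [of k] that by (simp add: Suc_le_eq)
    have "(\<Sum>j=1..J. \<psi> (D k * j) * (1 / 2)) \<le> (\<Sum>j=1..J. \<psi> (D k * j) * (real (totient j) / real j))"
    proof (rule decreasing_sum_mono)
      show "(\<Sum>j=1..J. 1 / 2) \<le> (\<Sum>j=1..J. real (totient j) / real j)" for J
        using sum_totient_ratio_ge [of J] by simp
    qed (use nonneg decreasing pos in auto)
    then have "c * (\<Sum>j=1..J. \<psi> (D k * j) * (1 / 2)) \<le> c * (\<Sum>j=1..J. \<psi> (D k * j) * (real (totient j) / real j))"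
      using c by (intro mult_left_mono) auto
    also have "\<dots> = (\<Sum>j=1..J. \<psi> (D k * j) * (c * (real (totient j) / real j)))"
      by (simp add: sum_distrib_left mult_ac)
    also have "\<dots> \<le> (\<Sum>j=1..J. \<psi> (D k * j) * (real (totient (D k * j)) / real (D k * j)))"
    proof (intro sum_mono mult_left_mono)
      fix j assume j: "j \<in> {1..J}"
      have "c * (real (totient j) / real j) \<le> real (totient (D k)) / real (D k) * (real (totient j) / real j)"
        by (intro mult_right_mono c) auto
      also have "\<dots> = real (totient (D k) * totient j) / real (D k * j)" by simp
      also have "\<dots> \<le> real (totient (D k * j)) / real (D k * j)"
        by (intro divide_right_mono of_nat_mono totient_mult_ge) auto
      finally show "c * (real (totient j) / real j) \<le> real (totient (D k * j)) / real (D k * j)" .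
    qed (use nonneg pos in auto)
    finally show ?thesis by (simp add: sum_distrib_left)
  qed
  let ?g = "\<lambda>n. \<psi> n * (real (totient n) / real n)"
  have "c / 2 * (\<Sum>n | n \<in> {1..N} \<and> D K dvd n. \<psi> n / pseudo_abs D n)
      \<le> c / 2 * (\<Sum>k=K..N. real (D k) * (\<Sum>j=1..N div D k. \<psi> (D k * j)))"
    using c by (intro mult_left_mono sum_over_pseudo_abs_bounds(1) [OF nonneg]) auto
  also have "\<dots> = (\<Sum>k=K..N. real (D k) * (c / 2 * (\<Sum>j=1..N div D k. \<psi> (D k * j))))"
    by (subst sum_distrib_left) (simp add: mult_ac)
  also have "\<dots> \<le> (\<Sum>k=K..N. real (D k) * (\<Sum>j=1..N div D k. ?g (D k * j)))"
    by (intro sum_mono mult_left_mono *) auto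
  also have "\<dots> \<le> 2 * (\<Sum>n | n \<in> {1..N} \<and> D K dvd n. ?g n / pseudo_abs D n)"
    using nonneg by (intro sum_over_pseudo_abs_bounds(2)) auto
  also have "(\<Sum>n | n \<in> {1..N} \<and> D K dvd n. ?g n / pseudo_abs D n)
      = (\<Sum>n | n \<in> {1..N} \<and> D K dvd n. real (totient n) / real n * (\<psi> n / pseudo_abs D n))"
    by (intro sum.cong) (auto simp: mult_ac)
  finally show ?thesis by simp
qed

end
end

section \<open>Overlaps of neighbourhoods of reduced fractions\<close>

text \<open>With d = gcd(m, n), m = d m' and n = d n', put h = a n' - b m', so |h| <= X/d. Reduced
  fractions with different denominators differ, hence h is nonzero and has at most 2 floor(X/d)
  values. Each value belongs to at most d pairs: h fixes a modulo m', there are d blocks of length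
  m' in {1..m}, and a determines b. Excluding h = 0 is what avoids an additive error term.\<close>

lemma card_close_reduced_fractions:
  fixes X :: real
  assumes "m \<noteq> n" "m > 0" "n > 0" "X \<ge> 0"
  shows "real (card {(a, b) \<in> totatives m \<times> totatives n. \<bar>real a * real n - real b * real m\<bar> \<le> X}) \<le> 2 * X"
proof -
  define d where "d = gcd m n"
  define m' where "m' = m div d"
  define n' where "n' = n div d"
  have mn: "m = d * m'" "n = d * n'" by (simp_all add: d_def m'_def n'_def)
  have d: "d > 0" using assms by (simp add: d_def)
  have pos: "m' > 0" "n' > 0" using mn assms by (auto intro: Nat.gr0I)
  have cop: "coprime m' n'" unfolding m'_def n'_def d_def using assms by (intro div_gcd_coprime) auto
  define S where "S = {(a, b) \<in> totatives m \<times> totatives n. \<bar>real a * real n - real b * real m\<bar> \<le> X}"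
  define h where "h = (\<lambda>(a, b). int a * int n' - int b * int m')"
  define Y where "Y = nat \<lfloor>X / real d\<rfloor>"
  \<comment> \<open>The second coordinate is the block of length m' containing a; totatives start at
    1, hence the shift to a - 1.\<close>
  have inj: "inj_on (\<lambda>p. (h p, (fst p - 1) div m')) S"
  proof (rule inj_onI, clarsimp)
    fix a b a1 b1
    assume S: "(a, b) \<in> S" "(a1, b1) \<in> S" and h: "h (a, b) = h (a1, b1)"
      and q: "(a - Suc 0) div m' = (a1 - Suc 0) div m'"
    have a: "a > 0" "a1 > 0" using S by (auto simp: S_def in_totatives_iff)
    have eq: "(int a - int a1) * int n' = (int b - int b1) * int m'"
      using h by (simp add: h_def algebra_simps)
    then have "int m' dvd (int a - int a1) * int n'" by simp
    then have "int m' dvd int a - int a1"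
      using cop by (simp add: coprime_dvd_mult_left_iff)
    then have "int m' dvd int (a - 1) - int (a1 - 1)" using a by (simp add: of_nat_diff)
    then have "(a - 1) mod m' = (a1 - 1) mod m'"
      by (metis mod_eq_dvd_iff of_nat_eq_iff zmod_int)
    then have "a - 1 = a1 - 1" using q by (metis One_nat_def div_mult_mod_eq)
    then have "a = a1" using a by simp
    moreover have "b = b1" using eq \<open>a = a1\<close> pos by simp
    ultimately show "a = a1 \<and> b = b1" by simp
  qed
  have img: "(\<lambda>p. (h p, (fst p - 1) div m')) ` S \<subseteq> ({- int Y..int Y} - {0}) \<times> {..<d}"
  proof clarify
    fix a b assume S: "(a, b) \<in> S"
    have ab: "0 < a" "a \<le> m" "coprime a m" "0 < b" "b \<le> n" "coprime b n"
      and X: "\<bar>real a * real n - real b * real m\<bar> \<le> X"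
      using S by (auto simp: S_def in_totatives_iff)
    have "h (a, b) \<noteq> 0"
    proof
      assume "h (a, b) = 0"
      then have "int a * int n' = int b * int m'" by (simp add: h_def)
      then have "a * n' = b * m'" by (metis of_nat_eq_iff of_nat_mult)
      then have eq: "a * n = b * m" by (simp add: mn mult_ac)
      have "m dvd n" using eq ab(3) by (metis coprime_commute coprime_dvd_mult_right_iff dvd_triv_right)
      moreover have "n dvd m" using eq ab(6) by (metis coprime_commute coprime_dvd_mult_right_iff dvd_triv_right)
      ultimately show False using assms by (simp add: dvd_antisym)
    qed
    moreover have "\<bar>h (a, b)\<bar> \<le> int Y"
    proof -
      have "real a * real n - real b * real m = real d * real_of_int (h (a, b))"
        unfolding h_def mn by (simp add: algebra_simps)
      then have "\<bar>real a * real n - real b * real m\<bar> = real d * \<bar>real_of_int (h (a, b))\<bar>"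
        by (simp add: abs_mult)
      then have "\<bar>real_of_int (h (a, b))\<bar> \<le> X / real d"
        using X d by (simp add: field_simps)
      then have "\<bar>h (a, b)\<bar> \<le> \<lfloor>X / real d\<rfloor>" by (simp add: le_floor_iff)
      then show ?thesis using assms d by (simp add: Y_def)
    qed
    moreover have "(a - 1) div m' < d"
    proof -
      have "a - 1 < d * m'" using ab mn by linarith
      then show ?thesis by (simp add: less_mult_imp_div_less)
    qed
    ultimately show "h (a, b) \<in> {- int Y..int Y} - {0} \<and> (fst (a, b) - 1) div m' \<in> {..<d}" by auto
  qed
  have "card S \<le> card (({- int Y..int Y} - {0}) \<times> {..<d})"
    by (rule card_inj_on_le [OF inj img]) auto
  also have "\<dots> = (nat (2 * int Y + 1) - 1) * d" by (simp add: card_cartesian_product)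
  also have "nat (2 * int Y + 1) - 1 = 2 * Y" by linarith
  finally have "real (card S) \<le> 2 * (real Y * real d)"
    by (metis mult.assoc of_nat_le_iff of_nat_mult of_nat_numeral)
  also have "real Y * real d \<le> X / real d * real d"
    using assms d by (intro mult_right_mono) (auto simp: Y_def)
  finally show ?thesis using d by (simp add: S_def)
qed

text \<open>The numerator is arbitrary here; reducedness enters only by summing over
  \<open>totatives n\<close>.\<close>

definition farey_interval :: "real \<Rightarrow> nat \<Rightarrow> nat \<Rightarrow> real set" where
  "farey_interval r n a = {(real a - r) / real n .. (real a + r) / real n}"

lemma farey_interval_measure:
  "n > 0 \<Longrightarrow> r \<ge> 0 \<Longrightarrow> measure lborel (farey_interval r n a) = 2 * r / real n"
  by (simp add: farey_interval_def divide_right_mono diff_divide_distrib [symmetric])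

lemma farey_interval_sets [measurable]: "farey_interval r n a \<in> sets borel"
  by (simp add: farey_interval_def)

lemma farey_interval_iff: "n > 0 \<Longrightarrow> x \<in> farey_interval r n a \<longleftrightarrow> \<bar>real n * x - real a\<bar> \<le> r"
  by (auto simp: farey_interval_def field_simps abs_le_iff)

lemma farey_interval_fmeasurable: "farey_interval r n a \<in> fmeasurable lborel"
  by (simp add: farey_interval_def fmeasurable_def emeasure_lborel_Icc_eq)

text \<open>Two intervals can meet only if |an - bm| <= X = rn + sm, which leaves at most 2X pairs,
  and each overlap is at most the shorter length \<open>\<delta>\<close>. In the product X times
  \<open>\<delta>\<close>, the part rn is paired with \<open>\<delta>\<close> <= 2s/n and the part
  sm with \<open>\<delta>\<close> <= 2r/m, so m and n cancel.\<close>

lemma sum_measure_overlap_le: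
  assumes "m \<noteq> n" "m > 0" "n > 0" "r \<ge> 0" "s \<ge> 0"
  shows "(\<Sum>a\<in>totatives m. \<Sum>b\<in>totatives n.
            measure lborel (farey_interval r m a \<inter> farey_interval s n b)) \<le> 8 * r * s"
proof -
  define X where "X = r * real n + s * real m"
  define \<delta> where "\<delta> = min (2 * r / real m) (2 * s / real n)"
  define P where "P = {(a, b) \<in> totatives m \<times> totatives n. \<bar>real a * real n - real b * real m\<bar> \<le> X}"
  have \<delta>: "\<delta> \<ge> 0" using assms by (simp add: \<delta>_def)
  have "measure lborel (farey_interval r m a \<inter> farey_interval s n b)
      \<le> (if \<bar>real a * real n - real b * real m\<bar> \<le> X then \<delta> else 0)" for a b
  proof (cases "farey_interval r m a \<inter> farey_interval s n b = {}")
    case False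
    then obtain x where x: "x \<in> farey_interval r m a" "x \<in> farey_interval s n b" by blast
    have "\<bar>real a * real n - real b * real m\<bar>
        = \<bar>real m * (real n * x - real b) - real n * (real m * x - real a)\<bar>"
      by (simp add: algebra_simps)
    also have "\<dots> \<le> real m * \<bar>real n * x - real b\<bar> + real n * \<bar>real m * x - real a\<bar>"
      by (rule order_trans [OF abs_triangle_ineq4]) (simp add: abs_mult)
    also have "\<dots> \<le> real m * s + real n * r"
      using x assms by (intro add_mono mult_left_mono) (auto simp: farey_interval_iff)
    finally have "\<bar>real a * real n - real b * real m\<bar> \<le> X" by (simp add: X_def algebra_simps)
    moreover have "measure lborel (farey_interval r m a \<inter> farey_interval s n b) \<le> \<delta>"
      using measure_mono_fmeasurable [OF Int_lower1 _ farey_interval_fmeasurable, of r m a "farey_interval s n b"]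
        measure_mono_fmeasurable [OF Int_lower2 _ farey_interval_fmeasurable, of "farey_interval r m a" s n b] assms
      by (simp add: \<delta>_def farey_interval_measure)
    ultimately show ?thesis by simp
  qed (simp add: \<delta>)
  then have "(\<Sum>a\<in>totatives m. \<Sum>b\<in>totatives n. measure lborel (farey_interval r m a \<inter> farey_interval s n b))
      \<le> (\<Sum>a\<in>totatives m. \<Sum>b\<in>totatives n. if \<bar>real a * real n - real b * real m\<bar> \<le> X then \<delta> else 0)"
    by (intro sum_mono)
  also have "\<dots> = (\<Sum>p\<in>totatives m \<times> totatives n.
      if p \<in> {(a, b). \<bar>real a * real n - real b * real m\<bar> \<le> X} then \<delta> else 0)"
    by (simp add: sum.cartesian_product case_prod_unfold)
  also have "\<dots> = (\<Sum>p\<in>P. \<delta>)"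
    by (subst sum.inter_restrict [symmetric]) (simp, rule sum.cong, auto simp: P_def)
  also have "\<dots> = real (card P) * \<delta>" by simp
  also have "\<dots> \<le> 2 * X * \<delta>"
    unfolding P_def using assms by (intro mult_right_mono card_close_reduced_fractions \<delta>) (auto simp: X_def)
  also have "\<dots> = 2 * (r * real n * \<delta>) + 2 * (s * real m * \<delta>)" by (simp add: X_def algebra_simps)
  also have "\<dots> \<le> 2 * (r * real n * (2 * s / real n)) + 2 * (s * real m * (2 * r / real m))"
    using assms by (intro add_mono mult_left_mono) (auto simp: \<delta>_def)
  also have "\<dots> = 8 * r * s" using assms by simp
  finally show ?thesis .
qed

text \<open>Since r < 1/2, intervals around distinct numerators are disjoint and only the diagonal
  survives.\<close>

lemma sum_measure_overlap_same:
  assumes "n > 0" "r \<ge> 0" "r < 1 / 2"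
  shows "(\<Sum>a\<in>totatives n. \<Sum>b\<in>totatives n.
            measure lborel (farey_interval r n a \<inter> farey_interval r n b)) = real (totient n) * (2 * r / real n)"
proof -
  have "measure lborel (farey_interval r n a \<inter> farey_interval r n b)
      = (if a = b then 2 * r / real n else 0)" for a b
  proof (cases "a = b")
    case False
    have "farey_interval r n a \<inter> farey_interval r n b = {}"
    proof (rule ccontr)
      assume "farey_interval r n a \<inter> farey_interval r n b \<noteq> {}"
      then obtain x where "\<bar>real n * x - real a\<bar> \<le> r" "\<bar>real n * x - real b\<bar> \<le> r"
        using assms by (auto simp: farey_interval_iff)
      then have "\<bar>real a - real b\<bar> < 1" using assms by linarith
      then show False using False by linarith
    qed
    then show ?thesis using False by simp
  qed (use assms in \<open>simp add: farey_interval_measure\<close>)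
  then show ?thesis by (simp add: totient_def)
qed

section \<open>A second moment criterion\<close>

text \<open>A Paley-Zygmund argument: with a the integral of G_N, the set where G_N > t has measure
  at least (1 - 2t/a)/C. Letting N grow with t fixed bounds the measure of \<open>B t\<close> below
  by 1/C, and the sets \<open>B t\<close> decrease to the required one inside the finite measure set
  A.\<close>

lemma second_moment_unbounded:
  fixes G :: "nat \<Rightarrow> 'a \<Rightarrow> real"
  assumes int: "\<And>N. integrable M (G N)" "\<And>N. integrable M (\<lambda>x. (G N x)\<^sup>2)"
    and A: "A \<in> fmeasurable M" "measure M A \<le> 1"
    and supp: "\<And>N x. x \<notin> A \<Longrightarrow> G N x = 0"
    and unbounded: "filterlim (\<lambda>N. integral\<^sup>L M (G N)) at_top sequentially"
    and second: "\<forall>\<^sub>F N in sequentially. (\<integral>x. (G N x)\<^sup>2 \<partial>M) \<le> C * (integral\<^sup>L M (G N))\<^sup>2"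
    and "C > 0"
  shows "measure M {x\<in>A. \<forall>t::nat. \<exists>N. G N x > real t} \<ge> 1 / C"
proof -
  have [measurable]: "G N \<in> borel_measurable M" for N using int(1) by blast
  have [measurable]: "A \<in> sets M" using A by auto
  have meas: "{x\<in>A. P x} \<in> sets M" if "Measurable.pred M P" for P
    using sets.Int [OF _ predE [OF that], of A] A sets.sets_into_space [of A M]
    by (auto simp: Int_def conj_commute intro: back_subst [where P = "\<lambda>s. s \<in> sets M"])
  have sub: "measure M {x\<in>A. P x} \<le> measure M {x\<in>A. Q x}" if "\<And>x. P x \<Longrightarrow> Q x"
    "Measurable.pred M P" "Measurable.pred M Q" for P Q
    using that A(1) meas by (intro measure_mono_fmeasurable) (auto intro: fmeasurableI2 [OF A(1)])
  define B where "B t = {x\<in>A. \<exists>N. G N x > real t}" for t :: nat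
  have B: "B t \<in> sets M" for t unfolding B_def by (rule meas) measurable
  have *: "(1 - 2 * real t / integral\<^sup>L M (G N)) / C \<le> measure M (B t)"
    if N: "(\<integral>x. (G N x)\<^sup>2 \<partial>M) \<le> C * (integral\<^sup>L M (G N))\<^sup>2" "integral\<^sup>L M (G N) > 0" for N t
  proof -
    define a where "a = integral\<^sup>L M (G N)"
    define T where "T = {x\<in>A. G N x > real t}"
    have T: "T \<in> sets M" unfolding T_def by (rule meas) measurable
    then have Tf: "T \<in> fmeasurable M" using A(1) by (rule_tac fmeasurableI2) (auto simp: T_def)
    \<comment> \<open>\<open>G \<le> t + G\<^sup>2 / (2\<lambda>) + (\<lambda> / 2) 1\<^bsub>G > t\<^esub>\<close> with the optimal \<open>\<lambda> = C a\<close>\<close>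
    have pos: "C * a > 0" using N \<open>C > 0\<close> by (simp add: a_def)
    have "a \<le> (\<integral>x. real t * indicator A x + ((G N x)\<^sup>2 / (2 * (C * a)) + C * a / 2 * indicator T x) \<partial>M)"
      unfolding a_def
    proof (rule integral_mono)
      fix x
      show "G N x \<le> real t * indicator A x + ((G N x)\<^sup>2 / (2 * (C * integral\<^sup>L M (G N)))
              + C * integral\<^sup>L M (G N) / 2 * indicator T x)"
      proof (cases "x \<in> T")
        case True
        have "0 \<le> (G N x - C * a)\<^sup>2 / (2 * (C * a))" using pos by simp
        also have "\<dots> = (G N x)\<^sup>2 / (2 * (C * a)) + C * a / 2 - G N x"
          using pos by (cases "a = 0 \<or> C = 0") (auto simp: power2_eq_square field_simps)
        finally show ?thesis using True by (simp add: a_def T_def)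
      next
        case False
        then have "G N x \<le> real t * indicator A x"
          using supp [of x N] by (auto simp: T_def indicator_def)
        then show ?thesis using False pos by (simp add: a_def add_increasing2)
      qed
    qed (use int A Tf in \<open>auto simp: fmeasurable_def\<close>)
    also have "\<dots> = real t * measure M A + ((\<integral>x. (G N x)\<^sup>2 \<partial>M) / (2 * (C * a)) + C * a / 2 * measure M T)"
      using int A Tf by (subst Bochner_Integration.integral_add Bochner_Integration.integral_add)
        (auto simp: fmeasurable_def)
    also have "\<dots> \<le> real t * 1 + (C * a\<^sup>2 / (2 * (C * a)) + C * a / 2 * measure M T)"
      using A N pos unfolding a_def [symmetric]
      by (intro add_mono mult_left_mono divide_right_mono) auto
    also have "C * a\<^sup>2 / (2 * (C * a)) = a / 2" using pos by (auto simp: power2_eq_square)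
    \<comment> \<open>The chain reads a <= t + a/2 + (C a/2) |T|, which is solved for |T|.\<close>
    finally have "(1 - 2 * real t / a) / C \<le> measure M T"
      using N \<open>C > 0\<close> by (simp add: a_def [symmetric] field_simps)
    also have "\<dots> \<le> measure M (B t)" unfolding T_def B_def by (rule sub) (auto, measurable)
    finally show ?thesis by (simp add: a_def)
  qed
  have Bt: "1 / C \<le> measure M (B t)" for t
  proof (rule tendsto_upperbound)
    have "(\<lambda>N. 2 * real t / integral\<^sup>L M (G N)) \<longlonglongrightarrow> 0"
      by (intro real_tendsto_divide_at_top [OF tendsto_const unbounded])
    then have "(\<lambda>N. (1 - 2 * real t / integral\<^sup>L M (G N)) / C) \<longlonglongrightarrow> (1 - 0) / C"
      using \<open>C > 0\<close> by (intro tendsto_divide tendsto_diff tendsto_const) auto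
    then show "(\<lambda>N. (1 - 2 * real t / integral\<^sup>L M (G N)) / C) \<longlonglongrightarrow> 1 / C" by simp
    show "\<forall>\<^sub>F N in sequentially. (1 - 2 * real t / integral\<^sup>L M (G N)) / C \<le> measure M (B t)"
      using second filterlim_at_top_dense [THEN iffD1, OF unbounded, rule_format, of 0]
      by eventually_elim (rule *)
  qed simp
  have "(\<lambda>t. measure M (B t)) \<longlonglongrightarrow> measure M (\<Inter>t. B t)"
  proof (rule Lim_measure_decseq)
    show "decseq B"
      unfolding decseq_def B_def by (auto intro: order_le_less_trans [OF of_nat_mono])
    show "emeasure M (B t) \<noteq> \<infinity>" for t
      using fmeasurableI2 [OF A(1) _ B [of t]] by (auto simp: B_def fmeasurable_def)
  qed (use B in auto)
  then have "1 / C \<le> measure M (\<Inter>t. B t)" by (rule LIMSEQ_le_const) (use Bt in auto)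
  also have "(\<Inter>t. B t) = {x\<in>A. \<forall>t::nat. \<exists>N. G N x > real t}" by (auto simp: B_def)
  finally show ?thesis .
qed

section \<open>Limsup sets\<close>

text \<open>Quantifying over integer numerators presents the limsup set through countable unions of
  closed conditions. Numerators need not be coprime to n, which is what makes the translation
  invariance below possible.\<close>

definition approx_set :: "nat set \<Rightarrow> (nat \<Rightarrow> real) \<Rightarrow> real set" where
  "approx_set S f = {x. infinite {n\<in>S. \<exists>a::int. \<bar>real n * x - of_int a\<bar> \<le> f n}}"

lemma approx_set_borel [measurable]: "approx_set S f \<in> sets borel"
proof -
  have "approx_set S f = (\<Inter>N. \<Union>n\<in>{n\<in>S. N \<le> n}. \<Union>a::int. {x. \<bar>real n * x - of_int a\<bar> \<le> f n})"
    unfolding approx_set_def infinite_nat_iff_unbounded_le by (simp add: set_eq_iff) blast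
  moreover have "{x. \<bar>real n * x - of_int a\<bar> \<le> f n} \<in> sets borel" for n and a :: int
    by measurable
  ultimately show ?thesis by (auto intro!: sets.countable_INT sets.countable_UN')
qed

text \<open>G_N(x) counts the reduced fractions a/n with n in S, n <= N, whose interval contains x.
  Its integral is at least 2cF_N, where F_N is the partial sum of f, and the overlap estimates bound
  its second moment by the integral plus 8 F_N^2. The second moment criterion then applies, and
  unboundedness of G_N(x) puts x into infinitely many of the sets.\<close>

lemma measure_approx_set_ge:
  assumes S: "\<And>n. n \<in> S \<Longrightarrow> n \<ge> 2" and f: "\<And>n. n \<in> S \<Longrightarrow> 0 \<le> f n" "\<And>n. n \<in> S \<Longrightarrow> f n < 1 / 2"
    and tot: "\<And>N. c * (\<Sum>n | n \<in> S \<and> n \<le> N. f n) \<le> (\<Sum>n | n \<in> S \<and> n \<le> N. real (totient n) / real n * f n)"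
    and "c > 0"
    and diverges: "filterlim (\<lambda>N. \<Sum>n | n \<in> S \<and> n \<le> N. f n) at_top sequentially"
  shows "1 / (1 + 2 / c\<^sup>2) \<le> measure lborel (approx_set S f \<inter> {0..1})"
proof -
  define T where "T N = {n. n \<in> S \<and> n \<le> N}" for N
  have fin: "finite (T N)" for N by (simp add: T_def)
  define g where "g n x = (\<Sum>a\<in>totatives n. indicat_real (farey_interval (f n) n a) x)" for n x
  define G where "G N x = (\<Sum>n\<in>T N. g n x)" for N x
  define F where "F N = (\<Sum>n\<in>T N. f n)" for N
  have int_ind: "integrable lborel (indicat_real (farey_interval r n a))" for r n a
    using farey_interval_fmeasurable [of r n a] by (simp add: fmeasurable_def)
  have int_ind2: "integrable lborel (indicat_real (farey_interval r n a \<inter> farey_interval r' n' a'))" for r n a r' n' a'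
    using fmeasurable.Int [OF farey_interval_fmeasurable farey_interval_fmeasurable, of r n a r' n' a']
    by (simp add: fmeasurable_def)
  have intG: "integrable lborel (G N)" for N
    unfolding G_def g_def by (intro Bochner_Integration.integrable_sum int_ind)
  have G2: "(G N x)\<^sup>2 = (\<Sum>n\<in>T N. \<Sum>m\<in>T N. \<Sum>a\<in>totatives n. \<Sum>b\<in>totatives m.
      indicat_real (farey_interval (f n) n a \<inter> farey_interval (f m) m b) x)" for N x
    by (simp add: G_def g_def power2_eq_square sum_product indicator_inter_arith)
  have intG2: "integrable lborel (\<lambda>x. (G N x)\<^sup>2)" for N
    unfolding G2 by (intro Bochner_Integration.integrable_sum int_ind2)
  have integral_G: "integral\<^sup>L lborel (G N) = 2 * (\<Sum>n\<in>T N. real (totient n) / real n * f n)" for N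
  proof -
    have "integral\<^sup>L lborel (G N)
        = (\<Sum>n\<in>T N. \<Sum>a\<in>totatives n. measure lborel (farey_interval (f n) n a))"
      unfolding G_def g_def
      by (simp add: Bochner_Integration.integral_sum Bochner_Integration.integrable_sum int_ind)
    also have "\<dots> = (\<Sum>n\<in>T N. 2 * (real (totient n) / real n * f n))"
      using S f by (intro sum.cong) (force simp: T_def farey_interval_measure totient_def)+
    finally show ?thesis by (simp add: sum_distrib_left)
  qed
  have integral_G2: "(\<integral>x. (G N x)\<^sup>2 \<partial>lborel) \<le> integral\<^sup>L lborel (G N) + 8 * (F N)\<^sup>2" for N
  proof -
    let ?I = "\<lambda>n m. \<Sum>a\<in>totatives n. \<Sum>b\<in>totatives m.
      measure lborel (farey_interval (f n) n a \<inter> farey_interval (f m) m b)"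
    have "(\<integral>x. (G N x)\<^sup>2 \<partial>lborel) = (\<Sum>n\<in>T N. \<Sum>m\<in>T N. ?I n m)"
      unfolding G2 by (simp add: Bochner_Integration.integral_sum Bochner_Integration.integrable_sum int_ind2)
    also have "\<dots> \<le> (\<Sum>n\<in>T N. \<Sum>m\<in>T N.
        (if n = m then 2 * (real (totient n) / real n * f n) else 0) + 8 * f n * f m)"
    proof (intro sum_mono)
      fix n m assume "n \<in> T N" "m \<in> T N"
      then have nm: "n \<in> S" "m \<in> S" "n > 0" "m > 0" using S by (force simp: T_def)+
      show "?I n m \<le> (if n = m then 2 * (real (totient n) / real n * f n) else 0) + 8 * f n * f m"
      proof (cases "n = m")
        case True
        then show ?thesis
          using sum_measure_overlap_same [of n "f n"] nm f(1) [of n] f(2) [of n] by (simp add: mult.left_commute)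
      next
        case False
        then show ?thesis using sum_measure_overlap_le [of n m "f n" "f m"] nm f by simp
      qed
    qed
    also have "\<dots> = integral\<^sup>L lborel (G N) + 8 * (F N)\<^sup>2"
      by (simp add: integral_G sum.distrib sum.delta' fin F_def power2_eq_square sum_product sum_distrib_left mult_ac)
    finally show ?thesis .
  qed
  have tot': "2 * c * F N \<le> integral\<^sup>L lborel (G N)" for N
    using tot [of N] unfolding integral_G F_def T_def by simp
  have F0: "F N \<ge> 0" for N unfolding F_def using f by (intro sum_nonneg) (auto simp: T_def)
  have lim: "filterlim (\<lambda>N. integral\<^sup>L lborel (G N)) at_top sequentially"
  proof (rule filterlim_at_top_mono)
    show "filterlim (\<lambda>N. 2 * c * F N) at_top sequentially"
      using diverges \<open>c > 0\<close> unfolding F_def T_def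
      by (intro filterlim_tendsto_pos_mult_at_top [OF tendsto_const]) auto
  qed (use tot' in auto)
  have "1 / (1 + 2 / c\<^sup>2) \<le> measure lborel {x\<in>{0..1}. \<forall>t::nat. \<exists>N. G N x > real t}"
  proof (rule second_moment_unbounded [OF intG intG2 _ _ _ lim])
    show "G N x = 0" if x: "x \<notin> {0..1}" for N x
    proof -
      have "x \<notin> farey_interval (f n) n a" if n: "n \<in> T N" and a: "a \<in> totatives n" for n a
      proof
        assume "x \<in> farey_interval (f n) n a"
        have n2: "n \<ge> 2" "f n < 1 / 2" using n S f by (auto simp: T_def)
        \<comment> \<open>As n >= 2, the numerator n is excluded; with radius below 1/(2n) all
          intervals stay inside (0, 1).\<close>
        have "0 < a" "a < n" using a n2 totatives_less [of a n] by (auto simp: in_totatives_iff)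
        then have a1: "1 \<le> real a" "real a \<le> real n - 1" by linarith+
        have "\<bar>real n * x - real a\<bar> < 1 / 2"
          using \<open>x \<in> farey_interval (f n) n a\<close> n2 by (simp add: farey_interval_iff)
        then have "0 < real n * x" "real n * x < real n * 1" using a1 by linarith+
        then have "0 < x" "x < 1" using n2 by (auto simp: zero_less_mult_iff)
        then show False using x by simp
      qed
      then show ?thesis by (simp add: G_def g_def)
    qed
    show "\<forall>\<^sub>F N in sequentially. (\<integral>x. (G N x)\<^sup>2 \<partial>lborel) \<le> (1 + 2 / c\<^sup>2) * (integral\<^sup>L lborel (G N))\<^sup>2"
      using filterlim_at_top [THEN iffD1, OF lim, rule_format, of 1]
    proof eventually_elim
      case (elim N)
      \<comment> \<open>F_N <= a/(2c) turns 8 F_N^2 into 2 a^2/c^2, and a <= a^2 absorbs the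
        diagonal term once a >= 1; the sum of the two is the constant 1 + 2/c^2.\<close>
      define a where "a = integral\<^sup>L lborel (G N)"
      have "a \<ge> 1" using elim by (simp add: a_def)
      have "(2 * c * F N)\<^sup>2 \<le> a\<^sup>2"
        using tot' [of N] F0 \<open>c > 0\<close> unfolding a_def by (intro power_mono) auto
      then have "8 * (F N)\<^sup>2 \<le> 2 / c\<^sup>2 * a\<^sup>2"
        using \<open>c > 0\<close> by (simp add: field_simps power_mult_distrib)
      moreover have "a \<le> a\<^sup>2" using \<open>a \<ge> 1\<close> by (simp add: self_le_power)
      ultimately show ?case using integral_G2 [of N] unfolding a_def by (simp add: algebra_simps)
    qed
  qed (use \<open>c > 0\<close> in \<open>auto simp: fmeasurable_def add_pos_nonneg\<close>)
  also have "\<dots> \<le> measure lborel (approx_set S f \<inter> {0..1})"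
  proof (rule measure_mono_fmeasurable)
    show "{x\<in>{0..1}. \<forall>t::nat. \<exists>N. G N x > real t} \<subseteq> approx_set S f \<inter> {0..1}"
    proof
      fix x assume "x \<in> {x\<in>{0..1}. \<forall>t::nat. \<exists>N. G N x > real t}"
      then have x01: "x \<in> {0..1}" and x: "\<forall>t::nat. \<exists>N. G N x > real t" by auto
      have "x \<in> approx_set S f"
      proof (rule ccontr)
        \<comment> \<open>Otherwise only finitely many n contribute at x, and every G_N(x) is
          bounded by their total contribution.\<close>
        assume "x \<notin> approx_set S f"
        then have finQ: "finite {n\<in>S. \<exists>a::int. \<bar>real n * x - of_int a\<bar> \<le> f n}" (is "finite ?Q")
          by (simp add: approx_set_def)
        have g0: "g n x = 0" if "n \<in> S - ?Q" for n
        proof -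
          have "x \<notin> farey_interval (f n) n a" for a :: nat
            using that S [of n] by (auto simp: farey_interval_iff dest!: spec [of _ "int a"])
          then show ?thesis by (simp add: g_def)
        qed
        have gn: "g n x \<ge> 0" for n by (simp add: g_def sum_nonneg)
        have "G N x \<le> (\<Sum>n\<in>?Q. g n x)" for N
        proof -
          have "G N x = (\<Sum>n\<in>T N \<inter> ?Q. g n x)"
            unfolding G_def using g0 fin by (intro sum.mono_neutral_right) (auto simp: T_def)
          also have "\<dots> \<le> (\<Sum>n\<in>?Q. g n x)" using finQ gn by (intro sum_mono2) auto
          finally show ?thesis .
        qed
        moreover obtain t :: nat where "(\<Sum>n\<in>?Q. g n x) < real t" using reals_Archimedean2 by blast
        moreover obtain N where "G N x > real t" using x by blast
        ultimately show False by (meson not_le order_trans less_imp_le le_less_trans)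
      qed
      with x01 show "x \<in> approx_set S f \<inter> {0..1}" by simp
    qed
    have [measurable]: "G N \<in> borel_measurable borel" for N using intG [of N] by (simp add: borel_measurable_integrable)
    have "{x. \<forall>t::nat. \<exists>N. G N x > real t} \<in> sets borel" by measurable
    then have "{0..1} \<inter> {x. \<forall>t::nat. \<exists>N. G N x > real t} \<in> sets borel" by auto
    then show "{x\<in>{0..1}. \<forall>t::nat. \<exists>N. G N x > real t} \<in> sets lborel" by (simp add: Int_def)
    show "approx_set S f \<inter> {0..1} \<in> fmeasurable lborel"
      by (rule fmeasurableI2 [of "{0..1}"]) (auto simp: fmeasurable_def)
  qed
  finally show ?thesis .
qed

section \<open>From invariance under small translations to full measure\<close>

lemma measure_lborel_translation:
  fixes A :: "real set"
  assumes "A \<in> sets borel"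
  shows "measure lborel ((\<lambda>x. c + x) ` A) = measure lborel A"
proof -
  have eq: "(\<lambda>x. c + x) ` A = (\<lambda>x. - c + x) -` A" by (force simp: image_iff)
  then have "(\<lambda>x. c + x) ` A \<in> sets borel"
    using measurable_sets [of "\<lambda>x. - c + x" borel borel A] assms by simp
  then show ?thesis
    using measure_translation [of c A] assms by (simp add: measure_completion)
qed

text \<open>Invariance gives all cells of length 1/d the same share of E. Exactly d of them make up
  [0, 1), and the remaining endpoint 1 is null.\<close>

lemma measure_periodic_ge:
  fixes E :: "real set" and d :: nat
  assumes E [measurable]: "E \<in> sets borel" and "d > 0"
    and per: "\<And>x i. x \<in> E \<Longrightarrow> x + of_int i / real d \<in> E"
    and ge: "measure lborel (E \<inter> {0..1}) \<ge> \<kappa>"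
  shows "measure lborel (E \<inter> {of_int i / real d ..< (of_int i + 1) / real d}) \<ge> \<kappa> / real d"
proof -
  define I where "I i = E \<inter> {of_int i / real d ..< (of_int i + 1) / real d}" for i :: int
  have I [measurable]: "I i \<in> sets borel" for i unfolding I_def by measurable
  have I_eq: "measure lborel (I i) = measure lborel (I 0)" for i
  proof -
    have "I i = (\<lambda>x. of_int i / real d + x) ` I 0"
    proof (intro equalityI subsetI)
      fix x assume x: "x \<in> I i"
      have "x + of_int (- i) / real d \<in> I 0"
        using x per [of x "- i"] by (auto simp: I_def add_divide_distrib)
      then show "x \<in> (\<lambda>x. of_int i / real d + x) ` I 0"
        by (intro image_eqI [where x = "x + of_int (- i) / real d"]) auto
    next
      fix x assume "x \<in> (\<lambda>x. of_int i / real d + x) ` I 0"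
      then obtain y where y: "x = y + of_int i / real d" "y \<in> I 0" by (auto simp: add.commute)
      then show "x \<in> I i" using per [of y i] by (auto simp: I_def add_divide_distrib)
    qed
    then show ?thesis using measure_lborel_translation [OF I] by simp
  qed
  have fm: "I i \<in> fmeasurable lborel" for i
    by (rule fmeasurableI2 [of "{of_int i / real d .. (of_int i + 1) / real d}"])
      (auto simp: fmeasurable_def I_def emeasure_lborel_Icc_eq)
  have "E \<inter> {0..1} \<subseteq> (\<Union>i\<in>{0..<int d}. I i) \<union> {1}"
  proof
    fix x assume x: "x \<in> E \<inter> {0..1}"
    show "x \<in> (\<Union>i\<in>{0..<int d}. I i) \<union> {1}"
    proof (cases "x = 1")
      case False
      then have "\<lfloor>real d * x\<rfloor> \<in> {0..<int d}"
        using x \<open>d > 0\<close> by (auto simp: floor_less_iff)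
      moreover have "x \<in> I \<lfloor>real d * x\<rfloor>"
        using x \<open>d > 0\<close> floor_correct [of "real d * x"] by (auto simp: I_def field_simps)
      ultimately show ?thesis by blast
    qed simp
  qed
  then have "\<kappa> \<le> measure lborel ((\<Union>i\<in>{0..<int d}. I i) \<union> {1})"
    using ge fm by (intro order_trans [OF ge] measure_mono_fmeasurable fmeasurable.Un fmeasurable.finite_UN)
      (auto simp: fmeasurable_def)
  also have "\<dots> \<le> measure lborel (\<Union>i\<in>{0..<int d}. I i) + measure lborel {1::real}"
    using fm by (intro measure_Un_le) auto
  also have "measure lborel (\<Union>i\<in>{0..<int d}. I i) \<le> (\<Sum>i\<in>{0..<int d}. measure lborel (I i))"
    by (intro measure_UNION_le) auto
  also have "\<dots> = (\<Sum>i\<in>{0..<int d}. measure lborel (I 0))" by (intro sum.cong refl I_eq)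
  also have "\<dots> = real d * measure lborel (I 0)" by simp
  finally have "\<kappa> \<le> real d * measure lborel (I i)" by (simp add: I_eq [of i])
  then show ?thesis using \<open>d > 0\<close> by (simp add: I_def field_simps)
qed

text \<open>A density argument tied to nested partitions. An open U containing the bounded part B'
  of B is exhausted by cells inside U, each filled by B' to at most the proportion 1 -
  \<open>\<kappa>\<close>, so |B'| <= (1 - \<open>\<kappa>\<close>) |U|. Outer regularity brings |U|
  arbitrarily close to |B'|; as |B'| is finite, it vanishes.\<close>

lemma null_of_local_density:
  fixes B :: "real set" and d :: "nat \<Rightarrow> nat"
  assumes B [measurable]: "B \<in> sets borel" and d: "\<And>k. d k > 0" "\<And>k. d k dvd d (Suc k)" "\<And>k. k \<le> d k"
    and "\<kappa> > 0"
    and dens: "\<And>k i. measure lborel (B \<inter> {of_int i / real (d k) ..< (of_int i + 1) / real (d k)}) \<le> (1 - \<kappa>) / real (d k)"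
  shows "B \<inter> {-R..R} \<in> null_sets lborel"
proof -
  define I where "I k i = {of_int i / real (d k) ..< (of_int i + 1) / real (d k)}" for k and i :: int
  define B' where "B' = B \<inter> {-R..R}"
  have B' [measurable]: "B' \<in> sets borel" unfolding B'_def by measurable
  \<comment> \<open>Needed so that \<open>ennreal (1 - \<kappa>)\<close> is not truncated to
    0.\<close>
  have "0 \<le> (1 - \<kappa>) / real (d 0)" using dens [of 0 0] order_trans measure_nonneg by blast
  then have \<kappa>1: "0 \<le> 1 - \<kappa>" using d(1) [of 0] by (simp add: zero_le_divide_iff)
  have I_sets [measurable]: "I k i \<in> sets borel" for k i by (simp add: I_def)
  have I_meas: "emeasure lborel (I k i) = ennreal (1 / real (d k))" for k i
    by (simp add: I_def add_divide_distrib)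
  have B'fin: "emeasure lborel B' < \<infinity>"
    using emeasure_mono [of B' "{-R..R}" lborel] by (auto simp: B'_def emeasure_lborel_Icc_eq less_top [symmetric] top_unique split: if_splits)
  have I_dens: "emeasure lborel (B' \<inter> I k i) \<le> ennreal (1 - \<kappa>) * emeasure lborel (I k i)" for k i
  proof -
    have fin: "emeasure lborel (B \<inter> I k i) < \<infinity>"
      using emeasure_mono [of "B \<inter> I k i" "I k i" lborel] I_meas [of k i]
      by (auto simp: I_def less_top [symmetric] top_unique)
    have "emeasure lborel (B' \<inter> I k i) \<le> emeasure lborel (B \<inter> I k i)"
      by (rule emeasure_mono) (auto simp: B'_def I_def)
    also have "\<dots> = ennreal (measure lborel (B \<inter> I k i))"
      using fin by (simp add: emeasure_eq_ennreal_measure)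
    also have "\<dots> \<le> ennreal ((1 - \<kappa>) * (1 / real (d k)))"
      using dens [of i k] by (intro ennreal_leI) (simp add: I_def)
    also have "\<dots> = ennreal (1 - \<kappa>) * emeasure lborel (I k i)"
      unfolding I_meas using \<kappa>1 by (simp only: ennreal_mult')
    finally show ?thesis .
  qed
  have disj: "disjoint_family_on (I k) Z" for k Z
    unfolding disjoint_family_on_def
  proof (intro ballI impI)
    fix i j :: int assume "i \<noteq> j"
    have "i = j" if "x \<in> I k i" "x \<in> I k j" for x
    proof -
      have "\<lfloor>x * real (d k)\<rfloor> = i" "\<lfloor>x * real (d k)\<rfloor> = j"
        using that d(1) [of k] by (auto simp: I_def floor_eq_iff field_simps)
      then show ?thesis by simp
    qed
    with \<open>i \<noteq> j\<close> show "I k i \<inter> I k j = {}" by blast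
  qed
  have key: "emeasure lborel B' \<le> ennreal (1 - \<kappa>) * emeasure lborel U" if U: "open U" "B' \<subseteq> U" for U
  proof -
    define Z where "Z k = {i. I k i \<subseteq> U}" for k
    \<comment> \<open>\<open>W k\<close> increases to \<open>U\<close> because the partitions are nested and their mesh tends to 0\<close>
    define W where "W k = (\<Union>i\<in>Z k. I k i)" for k
    have WB: "emeasure lborel (B' \<inter> W k) \<le> ennreal (1 - \<kappa>) * emeasure lborel U" for k
    proof -
      have "B' \<inter> W k = (\<Union>i\<in>Z k. B' \<inter> I k i)" by (auto simp: W_def)
      then have "emeasure lborel (B' \<inter> W k) = emeasure lborel (\<Union>i\<in>Z k. B' \<inter> I k i)" by simp
      also have "\<dots> = (\<integral>\<^sup>+i. emeasure lborel (B' \<inter> I k i) \<partial>count_space (Z k))"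
        using disj [of k "Z k"] 
        by (intro emeasure_UN_countable) (simp_all add: disjoint_family_on_def, blast)
      also have "\<dots> \<le> (\<integral>\<^sup>+i. ennreal (1 - \<kappa>) * emeasure lborel (I k i) \<partial>count_space (Z k))"
        by (intro nn_integral_mono I_dens)
      also have "\<dots> = ennreal (1 - \<kappa>) * (\<integral>\<^sup>+i. emeasure lborel (I k i) \<partial>count_space (Z k))"
        by (rule nn_integral_cmult) simp
      also have "(\<integral>\<^sup>+i. emeasure lborel (I k i) \<partial>count_space (Z k)) = emeasure lborel (W k)"
        unfolding W_def by (rule emeasure_UN_countable [symmetric, OF _ _ disj]) (auto simp: I_def)
      also have "\<dots> \<le> emeasure lborel U"
        using U by (intro emeasure_mono) (auto simp: W_def Z_def)
      finally show ?thesis by (simp add: mult_left_mono)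
    qed
    have W_step: "W k \<subseteq> W (Suc k)" for k
    proof
      fix x assume "x \<in> W k"
      then obtain i where i: "x \<in> I k i" "I k i \<subseteq> U" by (auto simp: W_def Z_def)
      obtain r where r: "d (Suc k) = d k * r" using d(2) by blast
      have r0: "r > 0" using r d(1) [of "Suc k"] by (auto intro: Nat.gr0I)
      \<comment> \<open>The finer cell around x stays in the coarser one: the endpoints i/d_k are
        multiples of 1/d_{k+1}, because d_{k+1} = d_k r.\<close>
      define j where "j = \<lfloor>x * real (d (Suc k))\<rfloor>"
      have xj: "x \<in> I (Suc k) j"
        using floor_correct [of "x * real (d (Suc k))"] d(1) [of "Suc k"] by (auto simp: I_def j_def field_simps)
      have "of_int i \<le> x * real (d k)" "x * real (d k) < of_int i + 1"
        using i(1) d(1) [of k] by (auto simp: I_def field_simps)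
      then have "of_int i * real r \<le> x * real (d k) * real r" "x * real (d k) * real r < (of_int i + 1) * real r"
        using r0 by (auto intro!: mult_right_mono mult_strict_right_mono)
      then have "of_int i * real r \<le> x * real (d (Suc k))" "x * real (d (Suc k)) < (of_int i + 1) * real r"
        by (simp_all add: r mult.assoc)
      then have "i * int r \<le> j" "j < (i + 1) * int r"
        unfolding j_def by (auto simp: le_floor_iff floor_less_iff)
      then have "real_of_int (i * int r) \<le> of_int j" "real_of_int (j + 1) \<le> of_int ((i + 1) * int r)"
        unfolding of_int_le_iff by auto
      then have ij: "of_int i * real r \<le> of_int j" "of_int j + 1 \<le> (of_int i + 1) * real r"
        by simp_all
      have e: "of_int i / real (d k) = of_int i * real r / real (d (Suc k))"
        "(of_int i + 1) / real (d k) = (of_int i + 1) * real r / real (d (Suc k))"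
        using r0 d(1) [of k] by (simp_all add: r)
      have "I (Suc k) j \<subseteq> I k i"
        unfolding I_def e using ij d(1) [of "Suc k"]
        by (auto intro: order_trans [OF divide_right_mono] order_less_le_trans [OF _ divide_right_mono])
      then show "x \<in> W (Suc k)" using i(2) xj by (auto simp: W_def Z_def)
    qed
    have UW: "\<exists>k. x \<in> W k" if "x \<in> U" for x
    proof -
      obtain e where e: "e > 0" "\<And>y. dist y x < e \<Longrightarrow> y \<in> U" using U(1) \<open>x \<in> U\<close> unfolding open_dist by blast
      obtain k :: nat where k: "1 / e < real k" using reals_Archimedean2 by blast
      then have "1 / e < real (d k)" using d(3) [of k] by linarith
      then have dk: "1 / real (d k) < e" using e d(1) [of k] by (simp add: field_simps)
      define i where "i = \<lfloor>x * real (d k)\<rfloor>"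
      have xi: "x \<in> I k i"
        using floor_correct [of "x * real (d k)"] d(1) [of k] by (auto simp: I_def i_def field_simps)
      have "I k i \<subseteq> U"
      proof
        fix y assume "y \<in> I k i"
        then have "\<bar>y - x\<bar> < 1 / real (d k)" using xi by (auto simp: I_def add_divide_distrib)
        then show "y \<in> U" using e(2) [of y] dk by (simp add: dist_real_def)
      qed
      then show ?thesis using xi by (auto simp: W_def Z_def)
    qed
    have Wm: "W k \<in> sets borel" for k unfolding W_def by (intro sets.countable_UN') (auto simp: I_def)
    have "emeasure lborel B' = emeasure lborel (\<Union>k. B' \<inter> W k)"
      using UW U(2) by (intro arg_cong [where f = "emeasure lborel"]) auto
    also have "\<dots> = (SUP k. emeasure lborel (B' \<inter> W k))"
      using W_step Wm by (intro SUP_emeasure_incseq [symmetric] incseq_SucI) auto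
    also have "\<dots> \<le> ennreal (1 - \<kappa>) * emeasure lborel U" by (intro SUP_least WB)
    finally show ?thesis .
  qed
  define b where "b = measure lborel B'"
  have b: "emeasure lborel B' = ennreal b" "b \<ge> 0"
    using B'fin by (auto simp: b_def emeasure_eq_ennreal_measure)
  have le: "b \<le> (1 - \<kappa>) * b + e" if "e > 0" for e
  proof -
    obtain U where U: "open U" "B' \<subseteq> U" "emeasure lborel (U - B') < ennreal e"
      using outer_regular_lborel [OF B' \<open>e > 0\<close>] by blast
    have "emeasure lborel U = emeasure lborel (B' \<union> (U - B'))" using U(2) by (intro arg_cong [where f = "emeasure lborel"]) auto
    also have "\<dots> \<le> emeasure lborel B' + emeasure lborel (U - B')"
      using U by (intro emeasure_subadditive) auto
    also have "\<dots> \<le> ennreal b + ennreal e" using U b by (intro add_mono) auto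
    also have "\<dots> = ennreal (b + e)" using b \<open>e > 0\<close> by simp
    finally have "ennreal b \<le> ennreal (1 - \<kappa>) * ennreal (b + e)"
      using key [OF U(1,2)] b by (metis mult_left_mono order_trans zero_le)
    then have "ennreal b \<le> ennreal ((1 - \<kappa>) * (b + e))" using \<kappa>1 by (simp only: ennreal_mult')
    then have "b \<le> (1 - \<kappa>) * (b + e)" using \<kappa>1 b \<open>e > 0\<close> by (subst (asm) ennreal_le_iff) auto
    also have "\<dots> \<le> (1 - \<kappa>) * b + e"
      using mult_right_mono [of "1 - \<kappa>" 1 e] \<open>\<kappa> > 0\<close> that by (simp add: algebra_simps)
    finally show ?thesis .
  qed
  have "b \<le> (1 - \<kappa>) * b" by (rule field_le_epsilon) (rule le)
  then have "\<kappa> * b \<le> 0" by (simp add: algebra_simps)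
  then have "b = 0" using \<open>\<kappa> > 0\<close> b(2) by (simp add: mult_le_0_iff)
  then have "B' \<in> null_sets lborel" using b B' by (intro null_setsI) auto
  then show ?thesis by (simp add: B'_def)
qed

section \<open>Distance to the nearest integer and the convergence case\<close>

text \<open>The integers are closed, so the infimum is attained and the non-strict bound passes to
  an actual integer.\<close>

lemma int_dist_le_iff: "int_dist x \<le> t \<longleftrightarrow> (\<exists>a::int. \<bar>x - of_int a\<bar> \<le> t)"
proof
  assume t: "int_dist x \<le> t"
  obtain y where "y \<in> \<int>" "infdist x \<int> = dist x y"
    using infdist_attains_inf [OF closed_Ints, of x] by blast
  then show "\<exists>a::int. \<bar>x - of_int a\<bar> \<le> t"
    using t by (auto simp: int_dist_def dist_real_def elim!: Ints_cases)
next
  assume "\<exists>a::int. \<bar>x - of_int a\<bar> \<le> t"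
  then obtain a :: int where "\<bar>x - of_int a\<bar> \<le> t" by blast
  then show "int_dist x \<le> t"
    unfolding int_dist_def using infdist_le [of "of_int a" \<int> x] by (auto simp: dist_real_def)
qed

lemma int_dist_le_half: "int_dist x \<le> 1 / 2"
  unfolding int_dist_le_iff using of_int_round_abs_le [of x] by (auto simp: abs_minus_commute)

text \<open>The integers nearest to nx for |x| <= R lie in {-(nR + 1)..nR + 1}, so 2nR + 3 intervals
  of length 2r/n suffice.\<close>

lemma measure_close_to_int_le:
  fixes R :: nat
  assumes n: "n > 0" and r: "r \<ge> 0"
  shows "measure lborel {x\<in>{- real R..real R}. \<exists>a::int. \<bar>real n * x - of_int a\<bar> \<le> r} \<le> (4 * real R + 6) * r"
proof -
  define B where "B = int (n * R) + 1"
  define J where "J a = {(of_int a - r) / real n .. (of_int a + r) / real n}" for a :: int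
  have "{x\<in>{- real R..real R}. \<exists>a::int. \<bar>real n * x - of_int a\<bar> \<le> r} \<subseteq> (\<Union>a\<in>{-B..B}. J a)"
  proof clarify
    fix x and a :: int assume x: "x \<in> {- real R..real R}" and a: "\<bar>real n * x - of_int a\<bar> \<le> r"
    \<comment> \<open>The given a may lie outside that range when r is large; rounding is at least
      as close and stays in range.\<close>
    let ?b = "round (real n * x)"
    have "\<bar>real n * x - of_int ?b\<bar> \<le> r"
      using round_diff_minimal [of "real n * x" a] a by linarith
    then have "x \<in> J ?b" using n by (auto simp: J_def field_simps abs_le_iff)
    moreover have "\<bar>real n * x\<bar> \<le> real n * real R" using x by (auto simp: abs_mult intro!: mult_left_mono)
    then have "\<bar>real_of_int ?b\<bar> \<le> real_of_int B"
      using of_int_round_abs_le [of "real n * x"] unfolding B_def by (simp, linarith)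
    then have "?b \<in> {-B..B}" by (auto simp: abs_le_iff simp flip: of_int_minus)
    ultimately show "x \<in> (\<Union>a\<in>{-B..B}. J a)" by blast
  qed
  moreover have "(\<Union>a\<in>{-B..B}. J a) \<in> fmeasurable lborel"
    by (intro fmeasurable.finite_UN) (auto simp: J_def fmeasurable_def emeasure_lborel_Icc_eq)
  moreover have "{x\<in>{- real R..real R}. \<exists>a::int. \<bar>real n * x - of_int a\<bar> \<le> r} \<in> sets lborel" by simp
  ultimately have "measure lborel {x\<in>{- real R..real R}. \<exists>a::int. \<bar>real n * x - of_int a\<bar> \<le> r}
      \<le> measure lborel (\<Union>a\<in>{-B..B}. J a)"
    by (intro measure_mono_fmeasurable)
  also have "\<dots> \<le> (\<Sum>a\<in>{-B..B}. measure lborel (J a))" by (intro measure_UNION_le) (auto simp: J_def)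
  also have "\<dots> = (\<Sum>a\<in>{-B..B}. 2 * r / real n)"
    using r n by (intro sum.cong) (auto simp: J_def divide_right_mono diff_divide_distrib [symmetric])
  also have "\<dots> = (2 * real n * real R + 3) * (2 * r / real n)" by (simp add: B_def)
  also have "\<dots> \<le> (real n * (2 * real R + 3)) * (2 * r / real n)"
    using r n by (intro mult_right_mono) (auto simp: algebra_simps)
  also have "\<dots> = (4 * real R + 6) * r" using n by (simp add: field_simps)
  finally show ?thesis .
qed

text \<open>Borel-Cantelli on each window [-R, R], where the measures are finite and summable,
  followed by a countable intersection over R.\<close>

lemma AE_finite_approx:
  assumes f: "\<And>n. n \<ge> 1 \<Longrightarrow> f n \<ge> 0" and summ: "summable (\<lambda>n. f (Suc n))"
  shows "AE x in lborel. finite {n. n \<ge> 1 \<and> (\<exists>a::int. \<bar>real n * x - of_int a\<bar> \<le> f n)}"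
proof -
  define A where "A R n = {x\<in>{- real R..real R}. \<exists>a::int. \<bar>real (Suc n) * x - of_int a\<bar> \<le> f (Suc n)}" for R n
  have A: "A R n \<in> sets lborel" for R n unfolding A_def by simp
  have "AE x in lborel. eventually (\<lambda>n. x \<in> space lborel - A R n) sequentially" for R
  proof (rule borel_cantelli_AE1 [OF A])
    show "emeasure lborel (A R n) < \<infinity>" for n
    proof -
      have "emeasure lborel (A R n) \<le> emeasure lborel {- real R..real R}"
        by (rule emeasure_mono) (auto simp: A_def)
      then show ?thesis by (simp add: le_less_trans)
    qed
    show "summable (\<lambda>n. measure lborel (A R n))"
    proof (rule summable_comparison_test')
      show "summable (\<lambda>n. (4 * real R + 6) * f (Suc n))" by (intro summable_mult summ)
      show "norm (measure lborel (A R n)) \<le> (4 * real R + 6) * f (Suc n)" for n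
        using measure_close_to_int_le [of "Suc n" "f (Suc n)" R] f unfolding A_def by simp
    qed
  qed
  then have "AE x in lborel. \<forall>R. eventually (\<lambda>n. x \<in> space lborel - A R n) sequentially"
    by (subst AE_all_countable) blast
  then show ?thesis
  proof eventually_elim
    case (elim x)
    obtain R :: nat where R: "\<bar>x\<bar> \<le> real R" using real_arch_simple by blast
    obtain N where N: "\<And>n. n \<ge> N \<Longrightarrow> x \<notin> A R n"
      using elim [rule_format, of R] by (auto simp: eventually_sequentially)
    have "n \<le> N" if "n \<ge> 1" "\<exists>a::int. \<bar>real n * x - of_int a\<bar> \<le> f n" for n
    proof (rule ccontr)
      assume "\<not> n \<le> N"
      then have "x \<notin> A R (n - 1)" by (intro N) simp
      then show False using that R by (auto simp: A_def abs_le_iff)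
    qed
    then show ?case by (intro finite_subset [OF _ finite_atMost [of N]]) auto
  qed
qed

lemma filterlim_sum_at_top_of_not_summable:
  fixes u :: "nat \<Rightarrow> real"
  assumes "\<And>n. 0 \<le> u n" "\<not> summable u"
  shows "filterlim (\<lambda>N. \<Sum>n<N. u n) at_top sequentially"
  unfolding filterlim_at_top
proof
  fix Z :: real
  have "\<exists>N. Z \<le> (\<Sum>n<N. u n)"
  proof (rule ccontr)
    assume "\<not> (\<exists>N. Z \<le> (\<Sum>n<N. u n))"
    then have "(\<Sum>n\<le>N. u n) \<le> Z" for N
      unfolding lessThan_Suc_atMost [symmetric] by (meson less_imp_le not_le)
    then have "summable u" using assms(1) by (intro bounded_imp_summable)
    with assms(2) show False by blast
  qed
  then obtain N where N: "Z \<le> (\<Sum>n<N. u n)" by blast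
  have "Z \<le> (\<Sum>n<M. u n)" if "M \<ge> N" for M
    using N sum_mono2 [of "{..<M}" "{..<N}" u] that assms(1) by auto
  then show "\<forall>\<^sub>F N in sequentially. Z \<le> (\<Sum>n<N. u n)" by (auto simp: eventually_sequentially)
qed

lemma approx_set_mono:
  assumes "S \<subseteq> T"
  shows "approx_set S f \<subseteq> approx_set T f"
proof
  fix x assume "x \<in> approx_set S f"
  moreover have "{n\<in>S. P n} \<subseteq> {n\<in>T. P n}" for P using assms by blast
  ultimately show "x \<in> approx_set T f"
    unfolding approx_set_def mem_Collect_eq by (rule infinite_super [rotated])
qed

text \<open>For n = dq, moving x by i/d moves nx by the integer qi, which the numerator
  absorbs.\<close>

lemma approx_set_periodic:
  assumes "\<And>n. n \<in> S \<Longrightarrow> d dvd n" "d > 0" "x \<in> approx_set S f"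
  shows "x + of_int i / real d \<in> approx_set S f"
proof -
  have "\<exists>a::int. \<bar>real n * (x + of_int i / real d) - of_int a\<bar> \<le> f n"
    if n: "n \<in> S" "\<bar>real n * x - of_int a\<bar> \<le> f n" for n and a :: int
  proof -
    obtain q where q: "n = d * q" using assms(1) n by blast
    have "real n * (x + of_int i / real d) - of_int (a + int q * i) = real n * x - of_int a"
      using \<open>d > 0\<close> by (simp add: q field_simps)
    then show ?thesis using n(2) by metis
  qed
  then have "{n\<in>S. \<exists>a::int. \<bar>real n * x - of_int a\<bar> \<le> f n}
      \<subseteq> {n\<in>S. \<exists>a::int. \<bar>real n * (x + of_int i / real d) - of_int a\<bar> \<le> f n}" by blast
  then show ?thesis using assms(3) finite_subset unfolding approx_set_def by blast
qed

section \<open>Combining the estimates in both cases\<close>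

theorem theorem2:
  fixes \<psi> :: "nat \<Rightarrow> real" and D :: "nat \<Rightarrow> nat"
  assumes nonneg: "\<And>n. n \<ge> 1 \<Longrightarrow> \<psi> n \<ge> 0"
    and decreasing: "\<And>m n. 1 \<le> m \<Longrightarrow> m \<le> n \<Longrightarrow> \<psi> n \<le> \<psi> m"
    and D: "pseudo_abs_seq D"
    and totient_avg: "\<exists>c>0. \<forall>N\<ge>1.
      (\<Sum>k=1..seq_count D N. real (totient (D k)) / real (D k)) \<ge> c * real (seq_count D N)"
  shows "(\<not> summable (\<lambda>n. real (seq_count D (Suc n)) * \<psi> (Suc n)) \<longrightarrow>
            (AE \<alpha> in lebesgue. infinite {n::nat. n \<ge> 1 \<and> pseudo_abs D n * int_dist (real n * \<alpha>) \<le> \<psi> n})) \<and>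
         (summable (\<lambda>n. real (seq_count D (Suc n)) * \<psi> (Suc n)) \<longrightarrow>
            (AE \<alpha> in lebesgue. finite {n::nat. n \<ge> 1 \<and> pseudo_abs D n * int_dist (real n * \<alpha>) \<le> \<psi> n}))"
proof -
  define f where "f n = \<psi> n / pseudo_abs D n" for n
  have f_nonneg: "f n \<ge> 0" if "n \<ge> 1" for n
    using nonneg pseudo_abs_pos [OF D that] that by (simp add: f_def)
  have sol_iff: "pseudo_abs D n * y \<le> \<psi> n \<longleftrightarrow> y \<le> f n" if "n \<ge> 1" for n y
    using pseudo_abs_pos [OF D that] by (simp add: f_def field_simps)
  have sol: "{n. n \<ge> 1 \<and> pseudo_abs D n * int_dist (real n * \<alpha>) \<le> \<psi> n}
      = {n. n \<ge> 1 \<and> (\<exists>a::int. \<bar>real n * \<alpha> - of_int a\<bar> \<le> f n)}" for \<alpha>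
    by (intro Collect_cong conj_cong refl) (simp add: sol_iff int_dist_le_iff)
  have term_nonneg: "0 \<le> real (seq_count D (Suc n)) * \<psi> (Suc n)" for n
    using nonneg by simp
  have count_ev: "\<forall>\<^sub>F n in sequentially. K \<le> seq_count D (Suc n)" for K
    unfolding eventually_sequentially
    by (rule exI [of _ "D K"]) (auto simp: le_seq_count_iff [OF D])

  have "AE \<alpha> in lebesgue. finite {n::nat. n \<ge> 1 \<and> pseudo_abs D n * int_dist (real n * \<alpha>) \<le> \<psi> n}"
    if summ: "summable (\<lambda>n. real (seq_count D (Suc n)) * \<psi> (Suc n))"
  proof -
    \<comment> \<open>M is eventually at least 1, so psi is dominated by M psi; this takes care of
      the constant 3 in the weight 2M + 3.\<close>
    have "summable (\<lambda>n. \<psi> (Suc n))"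
    proof (rule summable_comparison_test_ev [OF _ summ])
      show "\<forall>\<^sub>F n in sequentially. norm (\<psi> (Suc n)) \<le> real (seq_count D (Suc n)) * \<psi> (Suc n)"
        using count_ev [of 1]
      proof eventually_elim
        case (elim n)
        then show ?case using nonneg [of "Suc n"] mult_right_mono [of 1 "real (seq_count D (Suc n))" "\<psi> (Suc n)"] by simp
      qed
    qed
    then have "summable (\<lambda>n. 2 * (real (seq_count D (Suc n)) * \<psi> (Suc n)) + 3 * \<psi> (Suc n))"
      by (intro summable_add summable_mult summ)
    then have s: "summable (\<lambda>n. (2 * real (seq_count D (Suc n)) + 3) * \<psi> (Suc n))"
      by (simp add: algebra_simps)
    have "summable (\<lambda>n. f (Suc n))"
    proof (rule bounded_imp_summable)
      fix N
      have "(\<Sum>n\<le>N. f (Suc n)) = (\<Sum>n=1..Suc N. f n)"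
        unfolding One_nat_def sum.atLeast1_atMost_eq lessThan_Suc_atMost ..
      also have "\<dots> \<le> (\<Sum>m=1..Suc N. (2 * real (seq_count D m) + 3) * \<psi> m)"
        unfolding f_def by (rule sum_over_pseudo_abs_le [OF D nonneg decreasing])
      also have "\<dots> = (\<Sum>n<Suc N. (2 * real (seq_count D (Suc n)) + 3) * \<psi> (Suc n))"
        unfolding One_nat_def sum.atLeast1_atMost_eq ..
      also have "\<dots> \<le> (\<Sum>n. (2 * real (seq_count D (Suc n)) + 3) * \<psi> (Suc n))"
        using nonneg by (intro sum_le_suminf s) auto
      finally show "(\<Sum>n\<le>N. f (Suc n)) \<le> (\<Sum>n. (2 * real (seq_count D (Suc n)) + 3) * \<psi> (Suc n))" .
    qed (simp add: f_nonneg)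
    then have "AE \<alpha> in lborel. finite {n. n \<ge> 1 \<and> (\<exists>a::int. \<bar>real n * \<alpha> - of_int a\<bar> \<le> f n)}"
      by (intro AE_finite_approx f_nonneg)
    then show ?thesis unfolding sol by (rule AE_completion)
  qed
  moreover have "AE \<alpha> in lebesgue. infinite {n::nat. n \<ge> 1 \<and> pseudo_abs D n * int_dist (real n * \<alpha>) \<le> \<psi> n}"
    if not_summ: "\<not> summable (\<lambda>n. real (seq_count D (Suc n)) * \<psi> (Suc n))"
  \<comment> \<open>If f(n) >= 1/2 infinitely often, those n are solutions for every real number.
    Otherwise f is eventually below 1/2, as the disjointness of intervals demands.\<close>
  proof (cases "finite {n. n \<ge> 1 \<and> f n \<ge> 1 / 2}")
    case False
    have "{n. n \<ge> 1 \<and> f n \<ge> 1 / 2} \<subseteq> {n. n \<ge> 1 \<and> pseudo_abs D n * int_dist (real n * \<alpha>) \<le> \<psi> n}" for \<alpha>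
      using sol_iff int_dist_le_half order_trans by blast
    then show ?thesis using False finite_subset by (intro AE_I2) blast
  next
    case True
    then obtain N0 where N0: "\<And>n. n \<ge> 1 \<Longrightarrow> n \<ge> N0 \<Longrightarrow> f n < 1 / 2"
      using finite_nat_set_iff_bounded [of "{n. n \<ge> 1 \<and> f n \<ge> 1 / 2}"] by (auto simp: not_le) (meson not_le)
    obtain c where c: "c > 0" "\<And>N. N \<ge> 1 \<Longrightarrow>
        (\<Sum>k=1..seq_count D N. real (totient (D k)) / real (D k)) \<ge> c * real (seq_count D N)"
      using totient_avg by blast
    have tot: "real (totient (D k)) / real (D k) \<ge> c" for k
    proof (rule decreasing_average_ge [where u = "\<lambda>k. real (totient (D k)) / real (D k)"])
      show "real (totient (D j)) / real (D j) \<le> real (totient (D i)) / real (D i)" if "i \<le> j" for i j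
        by (intro totient_ratio_antimono pas_dvd [OF D that] pas_pos [OF D])
      show "real (totient (D k)) / real (D k) \<le> 1" for k
        using totient_le [of "D k"] pas_pos [OF D, of k] by simp
      \<comment> \<open>Taking N = n_M realises every M as a value of the counting function.\<close>
      show "(\<Sum>k=1..M. real (totient (D k)) / real (D k)) \<ge> c * real M" for M
        using c(2) [of "D M"] pas_pos [OF D, of M] by (simp add: seq_count_pas [OF D])
    qed
    \<comment> \<open>The bound of \<open>measure_approx_set_ge\<close> with c/4 in place of c; it
      does not depend on K.\<close>
    define \<kappa> where "\<kappa> = 1 / (1 + 2 / (c / 4)\<^sup>2)"
    have "\<kappa> > 0" unfolding \<kappa>_def by (intro divide_pos_pos add_pos_nonneg) auto
    define E where "E = approx_set {1..} f"
    have dens: "measure lborel (E \<inter> {of_int i / real (D K) ..< (of_int i + 1) / real (D K)}) \<ge> \<kappa> / real (D K)"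
      if K: "K \<ge> N0 + 2" for K i
    proof -
      define S where "S = {n. n \<ge> 1 \<and> D K dvd n}"
      \<comment> \<open>Together with K >= N0 + 2 this puts all of S in the range where n >= 2 and
        f(n) < 1/2.\<close>
      have S_ge: "n \<ge> K" if "n \<in> S" for n
        using that dvd_imp_le [of "D K" n] pas_ge [OF D, of K] by (auto simp: S_def)
      have S_eq: "{n. n \<in> S \<and> n \<le> N} = {n. n \<in> {1..N} \<and> D K dvd n}" for N by (auto simp: S_def)
      have "\<kappa> \<le> measure lborel (approx_set S f \<inter> {0..1})"
        unfolding \<kappa>_def
      proof (rule measure_approx_set_ge)
        show "n \<ge> 2" "0 \<le> f n" "f n < 1 / 2" if "n \<in> S" for n
          using S_ge [OF that] K f_nonneg N0 [of n] by auto
        show "c / 4 * (\<Sum>n | n \<in> S \<and> n \<le> N. f n) \<le> (\<Sum>n | n \<in> S \<and> n \<le> N. real (totient n) / real n * f n)" for N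
          unfolding S_eq f_def by (rule sum_over_pseudo_abs_totient_ge [OF D nonneg decreasing tot c(1)])
        show "c / 4 > 0" using c by simp
        \<comment> \<open>The weights left after restricting to multiples of n_K. Once M >= K, the
          inequality (K - 1)(M - K) >= 0 says M <= K (M + 1 - K), so the divergence of the series
          over M psi survives.\<close>
        define u where "u n = real (Suc (seq_count D (Suc n)) - K) * \<psi> (Suc n)" for n
        have "\<not> summable u"
        proof
          assume "summable u"
          then have Ku: "summable (\<lambda>n. real K * u n)" by (rule summable_mult)
          have "\<forall>\<^sub>F n in sequentially. norm (real (seq_count D (Suc n)) * \<psi> (Suc n)) \<le> real K * u n"
            using count_ev [of K]
          proof eventually_elim
            case (elim n)
            have "0 \<le> (real K - 1) * (real (seq_count D (Suc n)) - real K)"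
              using elim K by (intro mult_nonneg_nonneg) auto
            then have "real (seq_count D (Suc n)) \<le> real K * real (Suc (seq_count D (Suc n)) - K)"
              using elim by (simp add: of_nat_diff algebra_simps)
            then have "real (seq_count D (Suc n)) * \<psi> (Suc n) \<le> real K * real (Suc (seq_count D (Suc n)) - K) * \<psi> (Suc n)"
              using nonneg by (intro mult_right_mono) auto
            then show ?case using term_nonneg [of n] by (simp add: u_def mult.assoc)
          qed
          from summable_comparison_test_ev [OF this Ku] not_summ show False by contradiction
        qed
        then have lim: "filterlim (\<lambda>N. \<Sum>n<N. u n) at_top sequentially"
          using nonneg by (intro filterlim_sum_at_top_of_not_summable) (simp add: u_def, assumption)
        have "1 / 2 * (\<Sum>n<N. u n) \<le> (\<Sum>n | n \<in> S \<and> n \<le> N. f n)" for N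
          using sum_over_pseudo_abs_ge [where \<psi> = \<psi> and N = N and K = K, OF D nonneg decreasing]
          unfolding S_eq u_def f_def One_nat_def sum.atLeast1_atMost_eq by simp
        moreover have "filterlim (\<lambda>N. 1 / 2 * (\<Sum>n<N. u n)) at_top sequentially"
          by (rule filterlim_tendsto_pos_mult_at_top [OF tendsto_const _ lim]) simp
        ultimately show "filterlim (\<lambda>N. \<Sum>n | n \<in> S \<and> n \<le> N. f n) at_top sequentially"
          by (auto intro: filterlim_at_top_mono)
      qed
      then have "\<kappa> / real (D K) \<le> measure lborel (approx_set S f \<inter> {of_int i / real (D K) ..< (of_int i + 1) / real (D K)})"
        using pas_pos [OF D, of K]
        by (intro measure_periodic_ge approx_set_periodic) (auto simp: S_def)
      also have "\<dots> \<le> measure lborel (E \<inter> {of_int i / real (D K) ..< (of_int i + 1) / real (D K)})"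
      proof (rule measure_mono_fmeasurable)
        have "approx_set S f \<subseteq> E" unfolding E_def by (rule approx_set_mono) (auto simp: S_def)
        then show "approx_set S f \<inter> {of_int i / real (D K) ..< (of_int i + 1) / real (D K)}
            \<subseteq> E \<inter> {of_int i / real (D K) ..< (of_int i + 1) / real (D K)}" by blast
        show "E \<inter> {of_int i / real (D K) ..< (of_int i + 1) / real (D K)} \<in> fmeasurable lborel"
          by (rule fmeasurableI2 [of "{of_int i / real (D K) .. (of_int i + 1) / real (D K)}"])
            (auto simp: fmeasurable_def E_def emeasure_lborel_Icc_eq)
      qed simp
      finally show ?thesis .
    qed
    have [measurable]: "E \<in> sets borel" by (simp add: E_def)
    have "(- E) \<inter> {- real R..real R} \<in> null_sets lborel" for R :: nat
    \<comment> \<open>The partitions start at index N0 + 2, from where the uniform density bound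
      holds.\<close>
    proof (rule null_of_local_density [where d = "\<lambda>k. D (N0 + 2 + k)" and \<kappa> = \<kappa>])
      show "- E \<in> sets borel" by (simp add: borel_comp)
      show "D (N0 + 2 + k) > 0" for k by (rule pas_pos [OF D])
      show "D (N0 + 2 + k) dvd D (N0 + 2 + Suc k)" for k by (rule pas_dvd [OF D]) simp
      show "k \<le> D (N0 + 2 + k)" for k using pas_ge [OF D, of "N0 + 2 + k"] by simp
      fix k and i :: int
      define I where "I = {of_int i / real (D (N0 + 2 + k)) ..< (of_int i + 1) / real (D (N0 + 2 + k))}"
      have I: "I \<in> fmeasurable lborel" "measure lborel I = 1 / real (D (N0 + 2 + k))"
        by (simp_all add: I_def fmeasurable_def add_divide_distrib)
      have "measure lborel (- E \<inter> I) = measure lborel (I - E \<inter> I)"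
        by (intro arg_cong [where f = "measure lborel"]) auto
      also have "\<dots> = measure lborel I - measure lborel (E \<inter> I)"
        using I(1) by (intro measure_Diff) (auto simp: fmeasurable_def I_def)
      also have "\<dots> \<le> (1 - \<kappa>) / real (D (N0 + 2 + k))"
        using dens [of "N0 + 2 + k" i] I(2) by (simp add: I_def diff_divide_distrib)
      finally show "measure lborel (- E \<inter> {of_int i / real (D (N0 + 2 + k)) ..< (of_int i + 1) / real (D (N0 + 2 + k))})
          \<le> (1 - \<kappa>) / real (D (N0 + 2 + k))" by (simp add: I_def)
    qed (rule \<open>\<kappa> > 0\<close>)
    then have "(\<Union>R::nat. (- E) \<inter> {- real R..real R}) \<in> null_sets lborel" by (intro null_sets_UN) auto
    also have "(\<Union>R::nat. (- E) \<inter> {- real R..real R}) = - E"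
    proof -
      have "\<exists>R::nat. x \<in> {- real R..real R}" for x
        using real_arch_simple [of "\<bar>x\<bar>"] by (auto simp: abs_le_iff) (metis minus_le_iff)
      then show ?thesis by blast
    qed
    finally have "AE \<alpha> in lborel. \<alpha> \<in> E" by (rule AE_I') auto
    then have "AE \<alpha> in lborel. infinite {n. n \<ge> 1 \<and> (\<exists>a::int. \<bar>real n * \<alpha> - of_int a\<bar> \<le> f n)}"
      by eventually_elim (simp add: E_def approx_set_def)
    then show ?thesis unfolding sol by (rule AE_completion)
  qed
  ultimately show ?thesis by blast
qed

end
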